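(* Let $p\ge 1$ and $n\ge p+1$, and let $\mathbf{x}_1,\dots,\mathbf{x}_n\in\mathbb{C}^p$ be i.i.d. samples from the complex angular elliptical distribution $\mathcal{U}(\boldsymbol\Theta_0)$ with $\boldsymbol\Theta_0\succ 0$. Consider the unstructured case, where the constraint set is $\mathcal{S}'=\{\boldsymbol\Theta\in\mathbb{C}^{p\times p}:\boldsymbol\Theta=\boldsymbol\Theta^H\succeq 0,\ \mathrm{Tr}(\boldsymbol\Theta)=p\}$, and the COCA program $$\min_{\boldsymbol\Theta\in\mathcal{S}',\,d_1,\dots,d_n}\ \Big\|\boldsymbol\Theta-\frac1n\sum_{i=1}^n d_i\mathbf{x}_i\mathbf{x}_i^H\Big\|\quad\text{s.t.}\quad \boldsymbol\Theta\succeq \frac{1}{p}d_i\mathbf{x}_i\mathbf{x}_i^H,\ \ d_i>0,\ \ i=1,\dots,n,$$ where $\|\cdot\|$ is any matrix norm. Then, with probability one, the COCA estimator (the $\boldsymbol\Theta$-component of a minimizer of this program) is unique up to a positive scaling factor and coincides with Tyler's estimator, i.e. with the positive definite solution $\boldsymbol\Theta$ (unique up to positive scaling) of the fixed-point equation $$\boldsymbol\Theta=\frac{p}{n}\sum_{i=1}^n\frac{\mathbf{x}_i\mathbf{x}_i^H}{\mathbf{x}_i^H\boldsymbol\Theta^{-1}\mathbf{x}_i}.$$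
   Context: The complex angular elliptical distribution $\mathcal{U}(\boldsymbol\Theta_0)$, for a Hermitian $\boldsymbol\Theta_0\succ 0$, is the distribution on the complex unit sphere $\{\mathbf{x}\in\mathbb{C}^p:\|\mathbf{x}\|=1\}$ with density $p(\mathbf{x})=\frac{(p-1)!}{\pi^p}\frac{1}{|\boldsymbol\Theta_0|(\mathbf{x}^H\boldsymbol\Theta_0^{-1}\mathbf{x})^p}$; equivalently it is the law of $\mathbf{s}/\|\mathbf{s}\|$ for a generalized elliptical vector $\mathbf{s}=r\boldsymbol\Lambda\mathbf{u}$ with $\boldsymbol\Lambda\boldsymbol\Lambda^H=\boldsymbol\Theta_0$, $\mathbf{u}$ uniform on the complex unit sphere and $r\ge0$ a random variable with no atom at $0$. Here $\succeq$ denotes the Loewner order on Hermitian matrices and $|\cdot|$ the determinant. *)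

theory Defs
  imports "HOL-Probability.Probability"
begin

definition cadj :: "complex^'n^'m \<Rightarrow> complex^'m^'n" where
  "cadj A = (\<chi> i j. cnj (A $ j $ i))"

definition hermitian :: "complex^'n^'n \<Rightarrow> bool" where
  "hermitian A \<longleftrightarrow> cadj A = A"

definition qform :: "complex^'n^'n \<Rightarrow> complex^'n \<Rightarrow> complex" where
  "qform A v = (\<Sum>i\<in>UNIV. cnj (v $ i) * (A *v v) $ i)"

definition psd :: "complex^'n^'n \<Rightarrow> bool" where
  "psd A \<longleftrightarrow> hermitian A \<and> (\<forall>v. 0 \<le> Re (qform A v))"

definition pd :: "complex^'n^'n \<Rightarrow> bool" where
  "pd A \<longleftrightarrow> hermitian A \<and> (\<forall>v. v \<noteq> 0 \<longrightarrow> 0 < Re (qform A v))"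

definition loewner_ge :: "complex^'n^'n \<Rightarrow> complex^'n^'n \<Rightarrow> bool" where
  "loewner_ge A B \<longleftrightarrow> psd (A - B)"

definition outer :: "complex^'n \<Rightarrow> complex^'n^'n" where
  "outer x = (\<chi> i j. x $ i * cnj (x $ j))"

definition cscale :: "complex \<Rightarrow> complex^'n^'m \<Rightarrow> complex^'n^'m" where
  "cscale c A = (\<chi> i j. c * A $ i $ j)"

text \<open>Uniform distribution on the complex unit sphere of \<open>complex^'p\<close> (= real sphere
  of dimension 2p-1): normalised surface (= cone) measure, obtained as the law of
  \<open>y/\<parallel>y\<parallel>\<close> for \<open>y\<close> uniform on the unit ball w.r.t. Lebesgue measure.\<close>
definition uniform_csphere :: "(complex^'p) measure" where
  "uniform_csphere =
     distr (uniform_measure lborel (ball 0 1)) borel (\<lambda>y. (1 / norm y) *\<^sub>R y)"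

text \<open>Complex angular elliptical distribution \<open>\<U>(\<Theta>0)\<close>: law of \<open>s/\<parallel>s\<parallel>\<close> with
  \<open>s = r \<Lambda> u\<close>, \<open>\<Lambda> \<Lambda>^H = \<Theta>0\<close>, \<open>u\<close> uniform on the sphere, \<open>r > 0\<close> a.s.
  Since \<open>s/\<parallel>s\<parallel> = \<Lambda>u/\<parallel>\<Lambda>u\<parallel>\<close> whenever \<open>r > 0\<close>, this is the law of \<open>\<Lambda>u/\<parallel>\<Lambda>u\<parallel>\<close>.\<close>
definition angular_elliptical :: "complex^'p^'p \<Rightarrow> (complex^'p) measure" where
  "angular_elliptical \<Theta>0 =
     (let \<Lambda> = (SOME \<Lambda>. \<Lambda> ** cadj \<Lambda> = \<Theta>0)
      in distr (uniform_csphere :: (complex^'p) measure) borel (\<lambda>u. (1 / norm (\<Lambda> *v u)) *\<^sub>R (\<Lambda> *v u)))"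

definition is_matrix_norm :: "(complex^'p^'p \<Rightarrow> real) \<Rightarrow> bool" where
  "is_matrix_norm N \<longleftrightarrow>
     (\<forall>A. 0 \<le> N A) \<and> (\<forall>A. N A = 0 \<longleftrightarrow> A = 0) \<and>
     (\<forall>c A. N (cscale c A) = cmod c * N A) \<and> (\<forall>A B. N (A + B) \<le> N A + N B)"

definition S_unstruct :: "(complex^'p^'p) set" where
  "S_unstruct = {\<Theta>. psd \<Theta> \<and> trace \<Theta> = of_nat CARD('p)}"

definition coca_feasible ::
  "nat \<Rightarrow> (nat \<Rightarrow> complex^'p) \<Rightarrow> complex^'p^'p \<Rightarrow> (nat \<Rightarrow> real) \<Rightarrow> bool" where
  "coca_feasible n x \<Theta> d \<longleftrightarrow> \<Theta> \<in> S_unstruct \<and>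
     (\<forall>i<n. 0 < d i \<and>
        loewner_ge \<Theta> (cscale (complex_of_real (d i / real CARD('p))) (outer (x i))))"

definition coca_objective ::
  "(complex^'p^'p \<Rightarrow> real) \<Rightarrow> nat \<Rightarrow> (nat \<Rightarrow> complex^'p) \<Rightarrow> complex^'p^'p \<Rightarrow> (nat \<Rightarrow> real) \<Rightarrow> real" where
  "coca_objective N n x \<Theta> d =
     N (\<Theta> - cscale (complex_of_real (1 / real n))
               (\<Sum>i<n. cscale (complex_of_real (d i)) (outer (x i))))"

definition coca_minimizer ::
  "(complex^'p^'p \<Rightarrow> real) \<Rightarrow> nat \<Rightarrow> (nat \<Rightarrow> complex^'p) \<Rightarrow> complex^'p^'p \<Rightarrow> (nat \<Rightarrow> real) \<Rightarrow> bool" where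
  "coca_minimizer N n x \<Theta> d \<longleftrightarrow> coca_feasible n x \<Theta> d \<and>
     (\<forall>\<Theta>' d'. coca_feasible n x \<Theta>' d' \<longrightarrow> coca_objective N n x \<Theta> d \<le> coca_objective N n x \<Theta>' d')"

definition tyler_fixed_point :: "nat \<Rightarrow> (nat \<Rightarrow> complex^'p) \<Rightarrow> complex^'p^'p \<Rightarrow> bool" where
  "tyler_fixed_point n x \<Theta> \<longleftrightarrow> pd \<Theta> \<and>
     \<Theta> = cscale (complex_of_real (real CARD('p) / real n))
            (\<Sum>i<n. cscale (1 / qform (matrix_inv \<Theta>) (x i)) (outer (x i)))"

end

theory Submission
  imports Defs
begin

text \<open>
  Write \<open>A w = (\<Sum>i<n. w i x\<^sub>i x\<^sub>i\<^sup>H)\<close> for positive weights \<open>w\<close>. By Cauchy--Binet,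
  \<open>det (A w) = (\<Sum>S. c S * (\<Prod>i\<in>S. w i))\<close> over the \<open>p\<close>-subsets \<open>S\<close>, where \<open>c S > 0\<close> if the
  samples are in general position, which holds almost surely. The leverage \<open>w i * q i\<close> with
  \<open>q i = x\<^sub>i\<^sup>H (A w)\<^sup>-\<^sup>1 x\<^sub>i\<close> is the probability that \<open>S\<close> contains \<open>i\<close> when \<open>S\<close> is drawn with
  probability proportional to \<open>c S * (\<Prod>i\<in>S. w i)\<close>. So \<open>A w\<close> is a Tyler fixed point when all these
  marginals equal \<open>p / n\<close>, i.e. when \<open>t = ln w\<close> is a critical point of the convex function
  \<open>n * ln (det (A (exp t))) - p * (\<Sum>i<n. t i)\<close>. This function is coercive modulo constants as
  \<open>p < n\<close>, whence existence; equality of the marginals forces two such distributions on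
  \<open>p\<close>-subsets to coincide, whence uniqueness up to scaling.

  A Tyler fixed point gives the COCA program the value zero. Conversely, at value zero
  \<open>\<Theta> = A w\<close> with \<open>w = d / n\<close>, the Loewner constraints say that every leverage is at most \<open>p / n\<close>,
  and since the leverages add up to \<open>p\<close>, all of them equal \<open>p / n\<close>.
\<close>

section \<open>Sums over subsets of fixed size with equal marginals\<close>

text \<open>A homogeneous polynomial of degree \<open>p\<close>, affine in each weight; for
  \<open>c S = 1\<close> it is an elementary symmetric polynomial. Abstract coefficients keep the
  convexity argument apart from determinants, which enter through the positivity of
  \<open>c\<close>.\<close>

definition wsum :: "('a set \<Rightarrow> real) \<Rightarrow> nat \<Rightarrow> 'a set \<Rightarrow> ('a \<Rightarrow> real) \<Rightarrow> real" where
  "wsum c p I w = (\<Sum>S | S \<subseteq> I \<and> card S = p. c S * (\<Prod>i\<in>S. w i))"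

text \<open>For \<open>i \<in> I\<close> this is \<open>w i\<close> times the partial derivative of
  \<open>wsum\<close> in \<open>w i\<close>. Divided by \<open>wsum\<close> it is the marginal
  probability that the random subset contains \<open>i\<close>.\<close>

definition wsum_at :: "('a set \<Rightarrow> real) \<Rightarrow> nat \<Rightarrow> 'a set \<Rightarrow> ('a \<Rightarrow> real) \<Rightarrow> 'a \<Rightarrow> real" where
  "wsum_at c p I w i = (\<Sum>S | S \<subseteq> I \<and> card S = p \<and> i \<in> S. c S * (\<Prod>j\<in>S. w j))"

lemma finite_subsets_of_card: "finite I \<Longrightarrow> finite {S. S \<subseteq> I \<and> card S = p}"
  by (rule finite_subset[of _ "Pow I"]) auto

lemma wsum_cong:
  assumes "\<And>i. i \<in> I \<Longrightarrow> w i = v i"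
  shows "wsum c p I w = wsum c p I v"
  unfolding wsum_def using assms by (intro sum.cong arg_cong2[of _ _ _ _ "(*)"] prod.cong) auto

text \<open>Each weight enters a product at most once, so the dependence on a single weight is
  affine and the formula exact. It serves both to differentiate \<open>wsum\<close> and to follow a
  rank-one update of a determinant.\<close>

lemma wsum_update:
  assumes "finite I"
  shows "wsum c p I (w(i := w i * (1 + s))) = wsum c p I w + s * wsum_at c p I w i"
proof -
  let ?K = "{S. S \<subseteq> I \<and> card S = p}"
  have prod: "(\<Prod>j\<in>S. (w(i := w i * (1 + s))) j)
      = (\<Prod>j\<in>S. w j) + s * (if i \<in> S then \<Prod>j\<in>S. w j else 0)" if "S \<in> ?K" for S
  proof (cases "i \<in> S")
    case True
    have "finite S" using that assms finite_subset by auto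
    then show ?thesis using True
      by (simp add: prod.remove[of S i] algebra_simps)
  qed (auto intro!: prod.cong)
  have "wsum c p I (w(i := w i * (1 + s)))
      = wsum c p I w + s * (\<Sum>S\<in>?K. if i \<in> S then c S * (\<Prod>j\<in>S. w j) else 0)"
    unfolding wsum_def sum_distrib_left sum.distrib[symmetric]
    by (intro sum.cong refl) (simp only: prod, auto simp: algebra_simps)
  also have "(\<Sum>S\<in>?K. if i \<in> S then c S * (\<Prod>j\<in>S. w j) else 0) = wsum_at c p I w i"
    unfolding wsum_at_def
    by (subst sum.inter_filter[OF finite_subsets_of_card[OF assms], symmetric])
       (intro sum.cong, auto)
  finally show ?thesis .
qed

text \<open>Double counting of the pairs \<open>i \<in> S\<close>. After division by
  \<open>wsum\<close> this is linearity of expectation: the mean of the sum of \<open>f\<close> over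
  the random \<open>S\<close> depends on the marginals only.\<close>

lemma weighted_sum_wsum_at:
  assumes "finite I"
  shows "(\<Sum>i\<in>I. f i * wsum_at c p I w i)
    = (\<Sum>S | S \<subseteq> I \<and> card S = p. (\<Sum>i\<in>S. f i) * (c S * (\<Prod>j\<in>S. w j)))"
proof -
  let ?K = "{S. S \<subseteq> I \<and> card S = p}"
  let ?g = "\<lambda>S. c S * (\<Prod>j\<in>S. w j)"
  have "(\<Sum>i\<in>I. f i * wsum_at c p I w i) = (\<Sum>i\<in>I. \<Sum>S\<in>?K. if i \<in> S then f i * ?g S else 0)"
    unfolding wsum_at_def sum_distrib_left
    by (subst sum.inter_filter[OF finite_subsets_of_card[OF assms], symmetric])
       (intro sum.cong, auto)
  also have "\<dots> = (\<Sum>S\<in>?K. \<Sum>i\<in>I. if i \<in> S then f i * ?g S else 0)"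
    by (rule sum.swap)
  also have "\<dots> = (\<Sum>S\<in>?K. (\<Sum>i\<in>S. f i) * ?g S)"
  proof (intro sum.cong refl)
    fix S assume "S \<in> ?K"
    then have "{i \<in> I. i \<in> S} = S" by auto
    then show "(\<Sum>i\<in>I. if i \<in> S then f i * ?g S else 0) = (\<Sum>i\<in>S. f i) * ?g S"
      using assms by (simp add: sum.inter_filter[symmetric] sum_distrib_right)
  qed
  finally show ?thesis .
qed

text \<open>Euler's identity for a polynomial homogeneous of degree \<open>p\<close>; for
  determinants it says that the leverages add up to \<open>p\<close>.\<close>

lemma sum_wsum_at:
  assumes "finite I"
  shows "(\<Sum>i\<in>I. wsum_at c p I w i) = real p * wsum c p I w"
  using weighted_sum_wsum_at[OF assms, of "\<lambda>_. 1" c p w]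
  by (simp add: wsum_def sum_distrib_left)

lemma wsum_pos:
  assumes "finite I" "p \<le> card I"
    and c: "\<And>S. S \<subseteq> I \<Longrightarrow> card S = p \<Longrightarrow> 0 < c S" and w: "\<And>i. i \<in> I \<Longrightarrow> 0 < w i"
  shows "0 < wsum c p I w"
proof -
  obtain S where "S \<subseteq> I" "card S = p" by (meson assms(2) obtain_subset_with_card_n)
  then have "{S. S \<subseteq> I \<and> card S = p} \<noteq> {}" by auto
  then show ?thesis unfolding wsum_def
    using w by (intro sum_pos finite_subsets_of_card assms) (auto intro!: mult_pos_pos c prod_pos)
qed

lemma wsum_scale:
  "wsum c p I (\<lambda>i. a * w i) = a ^ p * wsum c p I w"
  unfolding wsum_def sum_distrib_left
  by (intro sum.cong) (auto simp: prod.distrib)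

lemma wsum_at_scale:
  "wsum_at c p I (\<lambda>i. a * w i) i = a ^ p * wsum_at c p I w i"
  unfolding wsum_at_def sum_distrib_left
  by (intro sum.cong) (auto simp: prod.distrib)

section \<open>Existence of weights with equal marginals\<close>

lemma ex_subset_of_largest:
  fixes t :: "'a \<Rightarrow> real"
  assumes "finite I" "p \<le> card I"
  shows "\<exists>S\<subseteq>I. card S = p \<and> (\<forall>i\<in>S. \<forall>j\<in>I - S. t j \<le> t i)"
  using assms(2)
proof (induction p)
  case 0
  then show ?case by (intro exI[of _ "{}"]) auto
next
  case (Suc p)
  then obtain S where S: "S \<subseteq> I" "card S = p" "\<forall>i\<in>S. \<forall>j\<in>I - S. t j \<le> t i" by auto
  have "finite S" using S assms finite_subset by auto
  have "I - S \<noteq> {}" using S Suc.prems by auto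
  then obtain k where k: "k \<in> I - S" "\<forall>j\<in>I - S. t j \<le> t k"
    using ex_is_arg_min_if_finite[of "I - S" "\<lambda>i. - t i"] assms(1)
    by (auto simp: is_arg_min_def not_less)
  show ?case
    using S k \<open>finite S\<close> by (intro exI[of _ "insert k S"]) auto
qed

text \<open>The right-hand side is the sum of \<open>t i - t j\<close> over \<open>i \<in> S\<close> and \<open>j \<in> I - S\<close>.\<close>
lemma top_subset_sum_bound:
  fixes t :: "'a \<Rightarrow> real"
  assumes I: "finite I" and S: "S \<subseteq> I" "card S = p" "0 < p" "p < card I"
    and top: "\<And>i j. i \<in> S \<Longrightarrow> j \<in> I - S \<Longrightarrow> t j \<le> t i"
    and ab: "a \<in> I" "b \<in> I"
  shows "t a - t b \<le> real (card I) * (\<Sum>i\<in>S. t i) - real p * (\<Sum>i\<in>I. t i)"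
proof -
  have fS: "finite S" using S I finite_subset by auto
  have cT: "card (I - S) = card I - p" using S fS by (simp add: card_Diff_subset)
  then have "0 < card (I - S)" using S by simp
  then have "I - S \<noteq> {}" unfolding card_gt_0_iff by simp
  moreover have "S \<noteq> {}" using S by auto
  ultimately obtain i1 j1 where ij1: "i1 \<in> S" "j1 \<in> I - S" by blast
  \<comment> \<open>Replacing \<open>a\<close> by an index inside \<open>S\<close> and
    \<open>b\<close> by one outside does not decrease the difference. All terms of the double sum
    below are nonnegative, so it dominates this single term.\<close>
  obtain i where i: "i \<in> S" "t a \<le> t i"
    using top[of i1 a] ab ij1 by (cases "a \<in> S") auto
  obtain j where j: "j \<in> I - S" "t j \<le> t b"
    using top[of b j1] ab ij1 by (cases "b \<in> S") auto
  have "t a - t b \<le> t i - t j" using i j by simp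
  also have "\<dots> = (\<lambda>(i, j). t i - t j) (i, j)" by simp
  also have "\<dots> \<le> (\<Sum>(i, j)\<in>S \<times> (I - S). t i - t j)"
    using i(1) j(1) top fS I by (intro member_le_sum) auto
  also have "\<dots> = real (card (I - S)) * (\<Sum>i\<in>S. t i) - real p * (\<Sum>j\<in>I - S. t j)"
    unfolding sum.cartesian_product[symmetric] by (simp add: sum_subtractf S(2) sum_distrib_left)
  also have "\<dots> = real (card I) * (\<Sum>i\<in>S. t i) - real p * (\<Sum>i\<in>I. t i)"
  proof -
    have "(\<Sum>i\<in>I - S. t i) = (\<Sum>i\<in>I. t i) - (\<Sum>i\<in>S. t i)" using S I by (intro sum_diff) auto
    moreover have "real (card (I - S)) = real (card I) - real p" using S cT by simp
    ultimately show ?thesis by (simp only: left_diff_distrib right_diff_distrib)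
  qed
  finally show ?thesis .
qed

text \<open>The summand of \<open>wsum\<close> that belongs to the \<open>p\<close> largest
  exponents already gives the bound. Adding a constant to \<open>t\<close> leaves the right-hand
  side unchanged, so only differences \<open>t a - t b\<close> can be controlled.\<close>

lemma log_wsum_coercive:
  assumes I: "finite I" and p: "0 < p" "p < card I"
    and c: "\<And>S. S \<subseteq> I \<Longrightarrow> card S = p \<Longrightarrow> c0 \<le> c S" "0 < c0"
    and ab: "a \<in> I" "b \<in> I"
  shows "real (card I) * ln c0 + (t a - t b)
    \<le> real (card I) * ln (wsum c p I (\<lambda>i. exp (t i))) - real p * (\<Sum>i\<in>I. t i)"
proof -
  obtain S where S: "S \<subseteq> I" "card S = p" "\<forall>i\<in>S. \<forall>j\<in>I - S. t j \<le> t i"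
    using ex_subset_of_largest[OF I, of p t] p by auto
  have pos: "0 < c S" if "S \<subseteq> I" "card S = p" for S using c(1)[OF that] c(2) by linarith
  have fS: "finite S" using S I finite_subset by auto
  have "c0 * exp (\<Sum>i\<in>S. t i) \<le> c S * (\<Prod>i\<in>S. exp (t i))"
    using c(1)[OF S(1,2)] by (simp add: exp_sum[OF fS] prod_nonneg mult_right_mono)
  also have "\<dots> \<le> wsum c p I (\<lambda>i. exp (t i))"
    unfolding wsum_def
  proof (rule member_le_sum)
    show "0 \<le> c x * (\<Prod>i\<in>x. exp (t i))" if "x \<in> {S. S \<subseteq> I \<and> card S = p} - {S}" for x
      using that pos[of x] by (simp add: prod_nonneg)
  qed (use S(1,2) I in \<open>simp_all add: finite_subsets_of_card\<close>)
  finally have "ln (c0 * exp (\<Sum>i\<in>S. t i)) \<le> ln (wsum c p I (\<lambda>i. exp (t i)))"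
    using c(2) by (intro ln_mono) auto
  then have "ln c0 + (\<Sum>i\<in>S. t i) \<le> ln (wsum c p I (\<lambda>i. exp (t i)))"
    using c(2) by (simp add: ln_mult)
  then have "real (card I) * (ln c0 + (\<Sum>i\<in>S. t i)) \<le> real (card I) * ln (wsum c p I (\<lambda>i. exp (t i)))"
    by (intro mult_left_mono) auto
  moreover have "t a - t b \<le> real (card I) * (\<Sum>i\<in>S. t i) - real p * (\<Sum>i\<in>I. t i)"
    using S(3) by (intro top_subset_sum_bound I S(1,2) p ab) auto
  ultimately show ?thesis by (simp add: algebra_simps)
qed

text \<open>Tychonoff's theorem, for boxes of functions on the whole index type.\<close>

lemma compact_Pi_UNIV:
  fixes B :: "'a \<Rightarrow> 'b::topological_space set"
  assumes "\<And>i. compact (B i)"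
  shows "compact (Pi UNIV B)"
  using assms compactin_PiE[of "\<lambda>_. euclidean" "UNIV :: 'a set" B]
  by (simp add: euclidean_product_topology PiE_UNIV_domain)

lemma log_wsum_has_minimizer:
  assumes I: "finite I" and p: "0 < p" "p < card I"
    and c: "\<And>S. S \<subseteq> I \<Longrightarrow> card S = p \<Longrightarrow> 0 < c S"
  defines "F \<equiv> \<lambda>t. real (card I) * ln (wsum c p I (\<lambda>i. exp (t i))) - real p * (\<Sum>i\<in>I. t i)"
  shows "\<exists>t. \<forall>t'. F t \<le> F t'"
proof -
  let ?K = "{S. S \<subseteq> I \<and> card S = p}"
  obtain S0 where "S0 \<subseteq> I" "card S0 = p"
    using p by (meson less_imp_le obtain_subset_with_card_n)
  then have K: "finite ?K" "?K \<noteq> {}"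
    using finite_subsets_of_card[OF I] by auto
  define c0 where "c0 = Min (c ` ?K)"
  have c0: "c0 \<le> c S" if "S \<subseteq> I" "card S = p" for S
    unfolding c0_def using K that by (intro Min_le) auto
  have c0_pos: "0 < c0"
    unfolding c0_def using K c by (subst Min_gr_iff) auto
  have coercive: "real (card I) * ln c0 + (t a - t b) \<le> F t" if "a \<in> I" "b \<in> I" for t a b
    unfolding F_def by (intro log_wsum_coercive I p c0 c0_pos that)
  obtain i0 where i0: "i0 \<in> I" using p by (metis card_gt_0_iff ex_in_conv not_less_zero neq0_conv)
  \<comment> \<open>By \<open>coercive\<close>, any \<open>t\<close> with a difference above
    \<open>R\<close> has a larger value of \<open>F\<close> than the zero function.\<close>
  define R where "R = F (\<lambda>_. 0) - real (card I) * ln c0"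
  have R0: "0 \<le> R" using coercive[OF i0 i0, of "\<lambda>_. 0"] unfolding R_def by simp
  define B where "B = Pi UNIV (\<lambda>_::'a. {-R..R})"
  have "compact B" unfolding B_def by (intro compact_Pi_UNIV) auto
  moreover have "(\<lambda>_. 0) \<in> B" using R0 unfolding B_def by auto
  moreover have "continuous_on B F"
  proof -
    have coord: "continuous_on B (\<lambda>t. t i)" for i
      by (rule continuous_on_subset[OF continuous_on_product_coordinates]) simp
    have "0 < wsum c p I (\<lambda>i. exp (t i))" for t
      using I p c by (intro wsum_pos) auto
    then have "\<forall>t\<in>B. wsum c p I (\<lambda>i. exp (t i)) \<noteq> 0"
      by (simp add: less_imp_neq[THEN not_sym])
    moreover have "continuous_on B (\<lambda>t. wsum c p I (\<lambda>i. exp (t i)))"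
      unfolding wsum_def by (intro continuous_intros coord)
    ultimately show ?thesis
      unfolding F_def by (intro continuous_intros coord)
  qed
  ultimately obtain t where t: "t \<in> B" "\<And>t'. t' \<in> B \<Longrightarrow> F t \<le> F t'"
    using continuous_attains_inf[of B F] by blast
  have "F t \<le> F t'" for t'
  proof -
    \<comment> \<open>Subtracting \<open>t' i0\<close> does not change \<open>F\<close>, by
      homogeneity, and values outside \<open>I\<close> do not matter. So either \<open>s\<close>
      lies in the box or some coordinate differs from \<open>s i0 = 0\<close> by more than
      \<open>R\<close>.\<close>
    define s where "s i = (if i \<in> I then t' i - t' i0 else 0)" for i
    have "wsum c p I (\<lambda>i. exp (s i)) = wsum c p I (\<lambda>i. exp (- t' i0) * exp (t' i))"
      by (intro wsum_cong) (simp add: s_def flip: exp_add)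
    then have "wsum c p I (\<lambda>i. exp (s i)) = exp (- t' i0) ^ p * wsum c p I (\<lambda>i. exp (t' i))"
      by (simp add: wsum_scale)
    moreover have "0 < wsum c p I (\<lambda>i. exp (t' i))" using I p c by (intro wsum_pos) auto
    moreover have "(\<Sum>i\<in>I. s i) = (\<Sum>i\<in>I. t' i) - real (card I) * t' i0"
      by (simp add: s_def sum_subtractf)
    ultimately have shift: "F s = F t'"
      unfolding F_def by (simp add: ln_mult ln_realpow right_diff_distrib distrib_left)
    show ?thesis
    proof (cases "s \<in> B")
      case True
      then show ?thesis using t shift by metis
    next
      case False
      then obtain a where a: "\<not> (- R \<le> s a \<and> s a \<le> R)" unfolding B_def Pi_iff by auto
      then have aI: "a \<in> I" using R0 by (cases "a \<in> I") (auto simp: s_def)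
      moreover have "s i0 = 0" by (simp add: s_def)
      ultimately have a: "a \<in> I" "R < s a - s i0 \<or> R < s i0 - s a" using a by auto
      then have "F (\<lambda>_. 0) < F s"
        using coercive[OF a(1) i0, of s] coercive[OF i0 a(1), of s] unfolding R_def by linarith
      then show ?thesis using t(2)[OF \<open>(\<lambda>_. 0) \<in> B\<close>] shift by simp
    qed
  qed
  then show ?thesis by blast
qed

lemma ex_equal_marginals:
  assumes I: "finite I" and p: "0 < p" "p < card I"
    and c: "\<And>S. S \<subseteq> I \<Longrightarrow> card S = p \<Longrightarrow> 0 < c S"
  shows "\<exists>w. (\<forall>i. 0 < w i) \<and> (\<forall>i\<in>I. real (card I) * wsum_at c p I w i = real p * wsum c p I w)"
proof -
  let ?F = "\<lambda>t. real (card I) * ln (wsum c p I (\<lambda>i. exp (t i))) - real p * (\<Sum>i\<in>I. t i)"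
  obtain t where t: "\<And>t'. ?F t \<le> ?F t'"
    using log_wsum_has_minimizer[of I p c] assms by blast
  define w where "w i = exp (t i)" for i
  have D: "0 < wsum c p I w" using I p c by (intro wsum_pos) (auto simp: w_def)
  have "real (card I) * wsum_at c p I w i = real p * wsum c p I w" if i: "i \<in> I" for i
  proof -
    \<comment> \<open>Up to an additive constant this is the objective when the weight of
      \<open>i\<close> is multiplied by \<open>1 + s\<close>; its derivative at zero is the defect
      in the marginal equation.\<close>
    define h where "h s = real (card I) * ln (wsum c p I w + s * wsum_at c p I w i) - real p * ln (1 + s)" for s
    have "(h has_real_derivative
        real (card I) * (wsum_at c p I w i / wsum c p I w) - real p) (at 0)"
      unfolding h_def using D by (auto intro!: derivative_eq_intros)
    moreover have "\<forall>s. \<bar>0 - s\<bar> < 1 \<longrightarrow> h 0 \<le> h s"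
    proof (intro allI impI)
      fix s :: real assume "\<bar>0 - s\<bar> < 1"
      then have s: "0 < 1 + s" by auto
      define t' where "t' = t(i := t i + ln (1 + s))"
      have "wsum c p I (\<lambda>i. exp (t' i)) = wsum c p I (w(i := w i * (1 + s)))"
        using s by (intro wsum_cong) (auto simp: t'_def w_def exp_add)
      then have "wsum c p I (\<lambda>i. exp (t' i)) = wsum c p I w + s * wsum_at c p I w i"
        using I by (simp add: wsum_update)
      moreover have "(\<Sum>i\<in>I. t' i) = (\<Sum>i\<in>I. t i) + ln (1 + s)"
        using I i by (simp add: t'_def sum.remove[of I i])
      ultimately show "h 0 \<le> h s"
        using t[of t'] unfolding h_def by (simp add: w_def[abs_def] algebra_simps)
    qed
    ultimately have "real (card I) * (wsum_at c p I w i / wsum c p I w) - real p = 0"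
      using DERIV_local_min[OF _ zero_less_one] by blast
    then show ?thesis using D by (simp add: field_simps)
  qed
  then show ?thesis by (intro exI[of _ w]) (auto simp: w_def)
qed

section \<open>Uniqueness of weights with equal marginals\<close>

text \<open>The symmetrised relative entropy of the two distributions on \<open>p\<close>-subsets is linear in the
  marginals, hence zero.\<close>
lemma equal_marginals_unique:
  assumes I: "finite I" and p: "0 < p" "p < card I"
    and c: "\<And>S. S \<subseteq> I \<Longrightarrow> card S = p \<Longrightarrow> 0 < c S"
    and w: "\<And>i. i \<in> I \<Longrightarrow> 0 < w i" "\<And>i. i \<in> I \<Longrightarrow> real (card I) * wsum_at c p I w i = real p * wsum c p I w"
    and v: "\<And>i. i \<in> I \<Longrightarrow> 0 < v i" "\<And>i. i \<in> I \<Longrightarrow> real (card I) * wsum_at c p I v i = real p * wsum c p I v"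
  shows "\<exists>a>0. \<forall>i\<in>I. v i = a * w i"
proof -
  let ?K = "{S. S \<subseteq> I \<and> card S = p}"
  define P where "P w S = c S * (\<Prod>i\<in>S. w i) / wsum c p I w" for w S
  define d where "d i = ln (v i) - ln (w i)" for i
  have Dw: "0 < wsum c p I w" and Dv: "0 < wsum c p I v"
    using I p c w v by (auto intro!: wsum_pos)
  have P_pos: "0 < P w S" "0 < P v S" if "S \<in> ?K" for S
    unfolding P_def using that Dw Dv w v c
    by (auto intro!: divide_pos_pos mult_pos_pos prod_pos)
  \<comment> \<open>All marginals are \<open>p / card I\<close>, so the mean of the sum of
    \<open>d\<close> over \<open>S\<close> is the same under both distributions.\<close>
  have mean: "(\<Sum>S\<in>?K. (\<Sum>i\<in>S. d i) * P u S) = (\<Sum>i\<in>I. d i) * (real p / real (card I))"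
    if D: "0 < wsum c p I u" and u: "\<And>i. i \<in> I \<Longrightarrow> real (card I) * wsum_at c p I u i = real p * wsum c p I u" for u
  proof -
    have "(\<Sum>S\<in>?K. (\<Sum>i\<in>S. d i) * P u S) = (\<Sum>i\<in>I. d i * wsum_at c p I u i) / wsum c p I u"
      by (simp only: weighted_sum_wsum_at[OF I] P_def sum_divide_distrib times_divide_eq_right)
    also have "\<dots> = (\<Sum>i\<in>I. d i * (real p / real (card I)))"
    proof -
      have "wsum_at c p I u i = (real p / real (card I)) * wsum c p I u" if "i \<in> I" for i
        using u[OF that] p by (simp add: field_simps)
      then show ?thesis using D unfolding sum_divide_distrib by (intro sum.cong) auto
    qed
    finally show ?thesis unfolding sum_distrib_right .
  qed
  have total: "(\<Sum>S\<in>?K. P u S) = 1" if "0 < wsum c p I u" for u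
    using that by (simp add: P_def flip: sum_divide_distrib wsum_def)
  define k where "k = ln (wsum c p I w) - ln (wsum c p I v)"
  \<comment> \<open>In the log-likelihood ratio the coefficient \<open>c S\<close> cancels, which
    leaves a sum over \<open>S\<close> plus a constant.\<close>
  have lnP: "ln (P v S) - ln (P w S) = (\<Sum>i\<in>S. d i) + k" if "S \<in> ?K" for S
  proof -
    have S: "finite S" "\<And>i. i \<in> S \<Longrightarrow> 0 < w i" "\<And>i. i \<in> S \<Longrightarrow> 0 < v i" "0 < c S"
      using that I finite_subset w v c by auto
    then have lnP: "ln (P u S) = ln (c S) + (\<Sum>i\<in>S. ln (u i)) - ln (wsum c p I u)"
      if "\<And>i. i \<in> S \<Longrightarrow> 0 < u i" "0 < wsum c p I u" for u
    proof -
      have pos: "0 < (\<Prod>i\<in>S. u i)" using that by (auto intro!: prod_pos)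
      have "ln (P u S) = ln (c S * (\<Prod>i\<in>S. u i)) - ln (wsum c p I u)"
        unfolding P_def using S(4) that(2) pos by (intro ln_divide_pos mult_pos_pos)
      also have "ln (c S * (\<Prod>i\<in>S. u i)) = ln (c S) + ln (\<Prod>i\<in>S. u i)"
        using S(4) pos by (intro ln_mult_pos)
      also have "ln (\<Prod>i\<in>S. u i) = (\<Sum>i\<in>S. ln (u i))"
        using S(1) by (intro ln_prod less_imp_neq[THEN not_sym] that(1))
      finally show ?thesis .
    qed
    show ?thesis
      using S Dw Dv by (simp add: lnP d_def k_def sum_subtractf)
  qed
  have "(\<Sum>S\<in>?K. (P v S - P w S) * (ln (P v S) - ln (P w S)))
      = (\<Sum>S\<in>?K. (\<Sum>i\<in>S. d i) * P v S) - (\<Sum>S\<in>?K. (\<Sum>i\<in>S. d i) * P w S)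
        + k * ((\<Sum>S\<in>?K. P v S) - (\<Sum>S\<in>?K. P w S))"
    by (simp add: lnP sum_subtractf sum_distrib_left algebra_simps sum.distrib)
  also have "\<dots> = 0" using mean[OF Dw w(2)] mean[OF Dv v(2)] total Dw Dv by simp
  finally have zero: "(\<Sum>S\<in>?K. (P v S - P w S) * (ln (P v S) - ln (P w S))) = 0" .
  have nonneg: "0 \<le> (P v S - P w S) * (ln (P v S) - ln (P w S))" if "S \<in> ?K" for S
  proof (cases "P v S \<le> P w S")
    case True
    then show ?thesis using P_pos[OF that] by (intro mult_nonpos_nonpos) simp_all
  next
    case False
    then show ?thesis using P_pos[OF that] by (intro mult_nonneg_nonneg) simp_all
  qed
  have sumd: "(\<Sum>i\<in>S. d i) = - k" if S: "S \<in> ?K" for S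
  proof -
    have "(P v S - P w S) * (ln (P v S) - ln (P w S)) = 0"
      using sum_nonneg_eq_0_iff[OF finite_subsets_of_card[OF I] nonneg, THEN iffD1, OF _ zero] S
      by blast
    \<comment> \<open>Since \<open>ln\<close> is strictly increasing, the zero product forces equal
      probabilities, and the log-ratio vanishes.\<close>
    then show ?thesis using P_pos[OF S] lnP[OF S] by auto
  qed
  have dconst: "d i = d j" if ij: "i \<in> I" "j \<in> I" "i \<noteq> j" for i j
  proof -
    \<comment> \<open>Exchange argument: as \<open>p < card I\<close>, some \<open>p - 1\<close>
      indices avoid both \<open>i\<close> and \<open>j\<close>. Completing them by \<open>i\<close>
      or by \<open>j\<close> gives two sums equal to \<open>- k\<close> that differ only in
      \<open>d i\<close> and \<open>d j\<close>.\<close>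
    have "p - 1 \<le> card (I - {i, j})" using p ij I by (simp add: card_Diff_subset)
    then obtain U where U: "U \<subseteq> I - {i, j}" "card U = p - 1"
      by (meson obtain_subset_with_card_n)
    then have "finite U" "i \<notin> U" "j \<notin> U" using I finite_subset by auto
    moreover from this have "insert i U \<in> ?K" "insert j U \<in> ?K" using U ij p by auto
    ultimately show ?thesis using sumd[of "insert i U"] sumd[of "insert j U"] by simp
  qed
  obtain i0 where i0: "i0 \<in> I" using p by (metis card_gt_0_iff ex_in_conv not_less_zero neq0_conv)
  have "v i = exp (d i0) * w i" if i: "i \<in> I" for i
  proof -
    have "d i = d i0" using dconst i i0 by metis
    then have "ln (v i) = d i0 + ln (w i)" unfolding d_def by simp
    then have "exp (ln (v i)) = exp (d i0) * exp (ln (w i))" by (simp add: exp_add)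
    then show ?thesis using w v i by simp
  qed
  then show ?thesis by (intro exI[of _ "exp (d i0)"]) auto
qed

section \<open>Hermitian forms and the determinant of a weighted sum of outer products\<close>

definition cdot :: "complex^'n \<Rightarrow> complex^'n \<Rightarrow> complex" where
  "cdot u v = (\<Sum>i\<in>UNIV. cnj (u $ i) * v $ i)"

lemma qform_eq_cdot: "qform A v = cdot v (A *v v)"
  by (simp add: qform_def cdot_def)

lemma cdot_add_right: "cdot u (v + w) = cdot u v + cdot u w"
  by (simp add: cdot_def algebra_simps sum.distrib)

lemma cdot_diff_right: "cdot u (v - w) = cdot u v - cdot u w"
  by (simp add: cdot_def algebra_simps sum_subtractf)

lemma cdot_diff_left: "cdot (u - v) w = cdot u w - cdot v w"
  by (simp add: cdot_def algebra_simps sum_subtractf)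

lemma cdot_smult_right: "cdot u (c *s v) = c * cdot u v"
  by (simp add: cdot_def sum_distrib_left algebra_simps)

lemma cdot_smult_left: "cdot (c *s u) v = cnj c * cdot u v"
  by (simp add: cdot_def sum_distrib_left algebra_simps)

lemma cdot_zero_right [simp]: "cdot u 0 = 0"
  by (simp add: cdot_def)

lemma cdot_sum_right: "cdot u (\<Sum>i\<in>I. v i) = (\<Sum>i\<in>I. cdot u (v i))"
  by (induction I rule: infinite_finite_induct) (simp_all add: cdot_add_right)

lemma cnj_cdot: "cnj (cdot u v) = cdot v u"
  by (simp add: cdot_def mult.commute)

lemma cdot_self: "cdot v v = complex_of_real ((norm v)\<^sup>2)"
  by (simp add: cdot_def norm_vec_def L2_set_def sum_nonneg complex_norm_square mult.commute
      del: of_real_power)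

lemma cdot_cadj: "cdot u (A *v v) = cdot (cadj A *v u) v"
  unfolding cdot_def cadj_def matrix_vector_mult_def
  by (simp add: sum_distrib_left sum_distrib_right mult_ac) (rule sum.swap)

lemma hermitian_cdot: "hermitian A \<Longrightarrow> cdot u (A *v v) = cdot (A *v u) v"
  unfolding hermitian_def by (metis cdot_cadj)

lemma hermitian_qform_real: "hermitian A \<Longrightarrow> qform A v = complex_of_real (Re (qform A v))"
  unfolding qform_eq_cdot
  by (metis Reals_cnj_iff cnj_cdot hermitian_cdot of_real_Re)

lemma cscale_mult_vec: "cscale c A *v v = c *s (A *v v)"
  by (simp add: cscale_def matrix_vector_mult_def vec_eq_iff sum_distrib_left mult.assoc)

lemma outer_mult_vec: "outer x *v v = cdot x v *s x"
  by (simp add: outer_def matrix_vector_mult_def vec_eq_iff cdot_def sum_distrib_left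
      sum_distrib_right mult_ac)

lemma qform_diff_outer:
  "Re (qform (A - cscale (complex_of_real s) (outer x)) v) = Re (qform A v) - s * (cmod (cdot x v))\<^sup>2"
proof -
  have "cdot x v * cdot v x = complex_of_real ((cmod (cdot x v))\<^sup>2)"
    by (metis cnj_cdot complex_norm_square)
  then have "qform (A - cscale (complex_of_real s) (outer x)) v
      = qform A v - complex_of_real (s * (cmod (cdot x v))\<^sup>2)"
    by (simp add: qform_eq_cdot matrix_vector_mult_diff_rdistrib cscale_mult_vec outer_mult_vec
        cdot_diff_right cdot_smult_right)
  then show ?thesis by simp
qed

lemma hermitian_diff_outer:
  "hermitian A \<Longrightarrow> hermitian (A - cscale (complex_of_real s) (outer x))"
  by (simp add: hermitian_def cadj_def cscale_def outer_def vec_eq_iff mult.commute)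

lemma hermitian_pd: "pd A \<Longrightarrow> hermitian A"
  by (simp add: pd_def)

lemma invertible_pd: assumes "pd A" shows "invertible A"
proof -
  have "v = 0" if "A *v v = 0" for v
    using assms that unfolding pd_def by (metis cdot_zero_right less_irrefl qform_eq_cdot zero_complex.sel(1))
  then show ?thesis
    by (metis invertible_left_inverse matrix_left_invertible_ker)
qed

lemma matrix_inv_mult:
  fixes A :: "complex^'n^'n"
  assumes "invertible A"
  shows "A ** matrix_inv A = mat 1" "matrix_inv A ** A = mat 1"
  using someI_ex[OF assms[unfolded invertible_def]] unfolding matrix_inv_def by auto

lemma mult_matrix_inv_vec:
  fixes A :: "complex^'n^'n"
  assumes "invertible A"
  shows "A *v (matrix_inv A *v v) = v"
  by (simp add: matrix_vector_mul_assoc matrix_inv_mult[OF assms])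

lemma qform_matrix_inv:
  assumes "pd A"
  shows "qform (matrix_inv A) x = qform A (matrix_inv A *v x)"
  using mult_matrix_inv_vec[OF invertible_pd[OF assms], of x]
    hermitian_cdot[OF hermitian_pd[OF assms], of "matrix_inv A *v x" "matrix_inv A *v x"]
  by (simp add: qform_eq_cdot)

lemma qform_matrix_inv_pos:
  assumes A: "pd A" and "x \<noteq> 0"
  obtains q where "0 < q" "qform (matrix_inv A) x = complex_of_real q"
proof
  have "matrix_inv A *v x \<noteq> 0"
    using assms mult_matrix_inv_vec[OF invertible_pd[OF A], of x] by auto
  then show "0 < Re (qform A (matrix_inv A *v x))" using A by (simp add: pd_def)
  show "qform (matrix_inv A) x = complex_of_real (Re (qform A (matrix_inv A *v x)))"
    using qform_matrix_inv[OF A] hermitian_qform_real[OF hermitian_pd[OF A]] by metis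
qed

text \<open>Cauchy-Schwarz in the inner product of \<open>A\<close> for \<open>v\<close> and
  \<open>y\<close>, the inverse of \<open>A\<close> applied to \<open>x\<close>. The nonnegative
  form is evaluated at \<open>q\<close> times the component of \<open>v\<close> orthogonal to
  \<open>y\<close>, that is at \<open>q v - b y\<close>.\<close>

lemma cdot_matrix_inv_bound:
  assumes A: "pd A" and q: "0 < q" "qform (matrix_inv A) x = complex_of_real q"
  shows "(cmod (cdot x v))\<^sup>2 \<le> q * Re (qform A v)"
proof -
  define y where "y = matrix_inv A *v x"
  define b where "b = cdot x v"
  define a where "a = Re (qform A v)"
  have Ay: "A *v y = x" unfolding y_def by (rule mult_matrix_inv_vec[OF invertible_pd[OF A]])
  have xy: "cdot x y = complex_of_real q" using q by (simp add: qform_eq_cdot y_def)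
  then have yx: "cdot y x = complex_of_real q" by (metis cnj_cdot complex_cnj_complex_of_real)
  have vx: "cdot v x = cnj b" by (simp add: b_def cnj_cdot)
  have yv: "cdot y (A *v v) = b"
    using hermitian_cdot[OF hermitian_pd[OF A], of y v] by (simp add: Ay b_def)
  have vv: "cdot v (A *v v) = complex_of_real a"
    using hermitian_qform_real[OF hermitian_pd[OF A], of v] by (simp add: a_def qform_eq_cdot)
  have "qform A (complex_of_real q *s v - b *s y)
      = complex_of_real (q * q * a) - complex_of_real q * (b * cnj b)"
    by (simp add: qform_eq_cdot matrix_vector_mult_diff_distrib vector_scalar_commute
        Ay cdot_diff_right cdot_diff_left cdot_smult_right cdot_smult_left vx yx yv vv algebra_simps)
  also have "\<dots> = complex_of_real (q * (q * a - (cmod b)\<^sup>2))"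
    unfolding complex_norm_square[symmetric] by (simp add: algebra_simps)
  finally have eq: "qform A (complex_of_real q *s v - b *s y)
    = complex_of_real (q * (q * a - (cmod b)\<^sup>2))" .
  have "0 \<le> Re (qform A u)" for u
    using A unfolding pd_def by (cases "u = 0") (auto simp: qform_eq_cdot less_imp_le)
  then have "0 \<le> q * (q * a - (cmod b)\<^sup>2)" by (metis Re_complex_of_real eq)
  then show ?thesis using q by (simp add: a_def b_def zero_le_mult_iff)
qed

text \<open>Necessity comes from testing the form at the inverse of \<open>A\<close> applied to
  \<open>x\<close>, sufficiency from Cauchy-Schwarz. With \<open>s = d i / p\<close> a COCA
  constraint becomes an upper bound on a leverage.\<close>

lemma loewner_ge_outer_iff:
  assumes A: "pd A" and q: "0 < q" "qform (matrix_inv A) x = complex_of_real q"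
  shows "loewner_ge A (cscale (complex_of_real s) (outer x)) \<longleftrightarrow> s * q \<le> 1"
proof
  assume "loewner_ge A (cscale (complex_of_real s) (outer x))"
  then have "0 \<le> Re (qform A (matrix_inv A *v x)) - s * (cmod (cdot x (matrix_inv A *v x)))\<^sup>2"
    unfolding loewner_ge_def psd_def by (metis qform_diff_outer)
  also have "\<dots> = q * (1 - s * q)"
    using q by (simp add: qform_matrix_inv[OF A, symmetric])
      (simp add: qform_eq_cdot power2_eq_square algebra_simps)
  finally show "s * q \<le> 1" using q by (simp add: zero_le_mult_iff)
next
  assume s: "s * q \<le> 1"
  show "loewner_ge A (cscale (complex_of_real s) (outer x))"
    unfolding loewner_ge_def psd_def
  proof (intro conjI allI hermitian_diff_outer hermitian_pd A)
    fix v
    have "s \<le> 1 / q" using s q by (simp add: field_simps)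
    then have "s * (cmod (cdot x v))\<^sup>2 \<le> 1 / q * (cmod (cdot x v))\<^sup>2"
      by (rule mult_right_mono) simp
    also have "\<dots> \<le> Re (qform A v)"
      using cdot_matrix_inv_bound[OF A q, of v] q by (simp add: field_simps)
    finally show "0 \<le> Re (qform (A - cscale (complex_of_real s) (outer x)) v)"
      by (simp add: qform_diff_outer)
  qed
qed

section \<open>Weighted sums of outer products and the Cauchy-Binet expansion\<close>

definition weighted_cov :: "nat \<Rightarrow> (nat \<Rightarrow> complex^'p) \<Rightarrow> (nat \<Rightarrow> real) \<Rightarrow> complex^'p^'p" where
  "weighted_cov n x w = (\<Sum>i<n. cscale (complex_of_real (w i)) (outer (x i)))"

lemma weighted_cov_nth:
  "weighted_cov n x w $ k $ l = (\<Sum>i<n. complex_of_real (w i) * (x i $ k * cnj (x i $ l)))"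
  by (simp add: weighted_cov_def cscale_def outer_def)

lemma weighted_cov_cong:
  "(\<And>i. i < n \<Longrightarrow> w i = v i) \<Longrightarrow> weighted_cov n x w = weighted_cov n x v"
  by (simp add: weighted_cov_def)

lemma weighted_cov_scale: "weighted_cov n x (\<lambda>i. a * w i) = a *\<^sub>R weighted_cov n x w"
proof -
  have "(a *\<^sub>R weighted_cov n x w) $ k $ l = a *\<^sub>R (weighted_cov n x w $ k $ l)" for k l
    by (simp only: vector_scaleR_component)
  then have "(a *\<^sub>R weighted_cov n x w) $ k $ l = complex_of_real a * weighted_cov n x w $ k $ l" for k l
    by (metis scaleR_conv_of_real)
  then show ?thesis by (simp add: vec_eq_iff weighted_cov_nth sum_distrib_left mult.assoc)
qed

lemma hermitian_weighted_cov: "hermitian (weighted_cov n x w)"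
  by (simp add: hermitian_def cadj_def vec_eq_iff weighted_cov_nth mult_ac)

lemma weighted_cov_mult_vec:
  "weighted_cov n x w *v v = (\<Sum>i<n. (complex_of_real (w i) * cdot (x i) v) *s x i)"
proof -
  have "weighted_cov n x w *v v = (\<Sum>i<n. cscale (complex_of_real (w i)) (outer (x i)) *v v)"
    unfolding weighted_cov_def
    by (induction n) (simp_all add: matrix_vector_mult_add_rdistrib)
  then show ?thesis by (simp add: cscale_mult_vec outer_mult_vec)
qed

lemma qform_weighted_cov:
  "qform (weighted_cov n x w) v = complex_of_real (\<Sum>i<n. w i * (cmod (cdot (x i) v))\<^sup>2)"
proof -
  have "cdot (x i) v * cdot v (x i) = complex_of_real ((cmod (cdot (x i) v))\<^sup>2)" for i
    by (metis cnj_cdot complex_norm_square)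
  then show ?thesis
    by (simp add: qform_eq_cdot weighted_cov_mult_vec cdot_sum_right cdot_smult_right mult.assoc)
qed

text \<open>The form is a sum of nonnegative terms; where it vanishes, every
  \<open>cdot (x i) v\<close> does, which puts \<open>v\<close> into the kernel.\<close>

lemma pd_weighted_cov:
  assumes w: "\<And>i. i < n \<Longrightarrow> 0 < w i" and inv: "invertible (weighted_cov n x w)"
  shows "pd (weighted_cov n x w)"
  unfolding pd_def
proof (intro conjI allI impI hermitian_weighted_cov)
  fix v :: "complex^'a" assume v: "v \<noteq> 0"
  have nn: "0 \<le> w i * (cmod (cdot (x i) v))\<^sup>2" if "i < n" for i
    using w[OF that] by simp
  have "(\<Sum>i<n. w i * (cmod (cdot (x i) v))\<^sup>2) \<noteq> 0"
  proof
    assume "(\<Sum>i<n. w i * (cmod (cdot (x i) v))\<^sup>2) = 0"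
    then have "w i * (cmod (cdot (x i) v))\<^sup>2 = 0" if "i < n" for i
      using nn that by (subst (asm) sum_nonneg_eq_0_iff) auto
    then have "cdot (x i) v = 0" if "i < n" for i
      using w[OF that] that by fastforce
    then have "weighted_cov n x w *v v = 0" by (simp add: weighted_cov_mult_vec)
    then show False using v inj_matrix_vector_mult[OF inv] by (metis injD matrix_vector_mult_0_right)
  qed
  moreover have "0 \<le> (\<Sum>i<n. w i * (cmod (cdot (x i) v))\<^sup>2)"
    using nn by (intro sum_nonneg) auto
  ultimately show "0 < Re (qform (weighted_cov n x w) v)"
    unfolding qform_weighted_cov Re_complex_of_real by linarith
qed

text \<open>For a set \<open>S\<close> of size \<open>p\<close> this is the squared modulus of the
  minor with rows \<open>x i\<close>, \<open>i \<in> S\<close>. The index type has no order, so all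
  \<open>p!\<close> enumerations \<open>f\<close> of \<open>S\<close> are averaged; they give the
  same modulus.\<close>

definition minor_weight :: "(nat \<Rightarrow> complex^'p) \<Rightarrow> nat set \<Rightarrow> real" where
  "minor_weight x S = (\<Sum>f | inj f \<and> range f = S. (cmod (det (\<chi> k::'p. x (f k))))\<^sup>2) / fact CARD('p)"

lemma prod_det_permute:
  fixes X :: "complex^'p^'p"
  shows "(\<Sum>\<pi> | \<pi> permutes UNIV. of_int (sign \<pi>) * (\<Prod>k\<in>UNIV. X $ \<pi> k $ k)) = det X"
  using det_transpose[of X] by (simp add: det_def transpose_def)

text \<open>The Leibniz expansion is a sum over all functions \<open>f\<close>; averaging it over the permutations of the
  arguments of \<open>f\<close> turns the diagonal product of the \<open>x (f k)\<close> into a second determinant.\<close>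
lemma det_weighted_cov_functions:
  fixes x :: "nat \<Rightarrow> complex^'p"
  shows "fact CARD('p) * det (weighted_cov n x w)
    = (\<Sum>f\<in>PiE (UNIV :: 'p set) (\<lambda>_. {..<n}).
         complex_of_real ((\<Prod>k\<in>UNIV. w (f k)) * (cmod (det (\<chi> k. x (f k))))\<^sup>2))"
proof -
  let ?F = "PiE (UNIV :: 'p set) (\<lambda>_. {..<n})"
  let ?P = "{\<pi>. \<pi> permutes (UNIV :: 'p set)}"
  let ?X = "\<lambda>f. (\<chi> k. x (f k)) :: complex^'p^'p"
  define W where "W f = complex_of_real (\<Prod>k\<in>UNIV. w (f k))" for f :: "'p \<Rightarrow> nat"
  define G where "G f = W f * (\<Prod>k\<in>UNIV. x (f k) $ k) * cnj (det (?X f))" for f :: "'p \<Rightarrow> nat"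
  have "det (weighted_cov n x w) = (\<Sum>\<sigma>\<in>?P. of_int (sign \<sigma>) *
      (\<Prod>k\<in>UNIV. \<Sum>i<n. complex_of_real (w i) * (x i $ k * cnj (x i $ \<sigma> k))))"
    by (simp add: det_def weighted_cov_nth)
  also have "\<dots> = (\<Sum>\<sigma>\<in>?P. \<Sum>f\<in>?F. of_int (sign \<sigma>) *
      (\<Prod>k\<in>UNIV. complex_of_real (w (f k)) * (x (f k) $ k * cnj (x (f k) $ \<sigma> k))))"
    by (subst prod_sum_PiE) (simp_all add: sum_distrib_left)
  also have "\<dots> = (\<Sum>f\<in>?F. \<Sum>\<sigma>\<in>?P. of_int (sign \<sigma>) *
      (\<Prod>k\<in>UNIV. complex_of_real (w (f k)) * (x (f k) $ k * cnj (x (f k) $ \<sigma> k))))"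
    by (rule sum.swap)
  also have "\<dots> = (\<Sum>f\<in>?F. G f)"
    unfolding G_def W_def det_def
    by (simp add: prod.distrib sum_distrib_left mult_ac)
  finally have det_G: "det (weighted_cov n x w) = (\<Sum>f\<in>?F. G f)" .
  have reindex: "(\<Sum>f\<in>?F. G f) = (\<Sum>f\<in>?F. G (f \<circ> \<pi>))" if "\<pi> \<in> ?P" for \<pi>
  proof -
    have "bij \<pi>" using that permutes_bij by auto
    then show ?thesis
      by (intro sum.reindex_bij_witness[of _ "\<lambda>f. f \<circ> \<pi>" "\<lambda>f. f \<circ> inv \<pi>"])
         (auto simp: PiE_UNIV_domain o_assoc[symmetric] bij_is_inj bij_is_surj surj_iff[THEN iffD1])
  qed
  \<comment> \<open>The weights are invariant under permuting the arguments and the conjugated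
    determinant picks up a sign. Summed over the permutations, the signed diagonal products form the
    second determinant.\<close>
  have G_perm: "G (f \<circ> \<pi>) = W f * cnj (det (?X f)) * (of_int (sign \<pi>) * (\<Prod>k\<in>UNIV. ?X f $ \<pi> k $ k))"
    if "\<pi> \<in> ?P" for f \<pi>
  proof -
    have "W (f \<circ> \<pi>) = W f"
      unfolding W_def using prod.permute[of \<pi> UNIV "\<lambda>k. w (f k)"] that by (simp add: o_def)
    moreover have "det (?X (f \<circ> \<pi>)) = of_int (sign \<pi>) * det (?X f)"
      using det_permute_rows[of \<pi> "?X f"] that by simp
    ultimately show ?thesis unfolding G_def by (simp add: mult_ac)
  qed
  have "fact CARD('p) * det (weighted_cov n x w) = (\<Sum>\<pi>\<in>?P. \<Sum>f\<in>?F. G f)"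
    by (simp add: det_G card_permutations[OF refl])
  also have "\<dots> = (\<Sum>\<pi>\<in>?P. \<Sum>f\<in>?F. G (f \<circ> \<pi>))"
    by (intro sum.cong reindex) auto
  also have "\<dots> = (\<Sum>f\<in>?F. \<Sum>\<pi>\<in>?P. G (f \<circ> \<pi>))"
    by (rule sum.swap)
  also have "\<dots> = (\<Sum>f\<in>?F. W f * cnj (det (?X f)) * det (?X f))"
  proof (intro sum.cong refl)
    fix f
    have "(\<Sum>\<pi>\<in>?P. G (f \<circ> \<pi>))
        = (\<Sum>\<pi>\<in>?P. W f * cnj (det (?X f)) * (of_int (sign \<pi>) * (\<Prod>k\<in>UNIV. ?X f $ \<pi> k $ k)))"
      by (intro sum.cong refl G_perm)
    then show "(\<Sum>\<pi>\<in>?P. G (f \<circ> \<pi>)) = W f * cnj (det (?X f)) * det (?X f)"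
      unfolding sum_distrib_left[symmetric] prod_det_permute .
  qed
  also have "\<dots> = (\<Sum>f\<in>?F. complex_of_real ((\<Prod>k\<in>UNIV. w (f k)) * (cmod (det (?X f)))\<^sup>2))"
  proof (intro sum.cong refl)
    fix f
    show "W f * cnj (det (?X f)) * det (?X f)
      = complex_of_real ((\<Prod>k\<in>UNIV. w (f k)) * (cmod (det (?X f)))\<^sup>2)"
      unfolding of_real_mult complex_norm_square by (simp add: W_def mult_ac)
  qed
  finally show ?thesis .
qed

text \<open>The Cauchy-Binet formula: a function that is not injective gives two equal rows, and the
  injective ones are grouped by their range, which determines the product of the weights.\<close>

lemma det_weighted_cov:
  fixes x :: "nat \<Rightarrow> complex^'p"
  shows "det (weighted_cov n x w) = complex_of_real (wsum (minor_weight x) CARD('p) {..<n} w)"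
proof -
  let ?F = "PiE (UNIV :: 'p set) (\<lambda>_. {..<n})"
  let ?K = "{S. S \<subseteq> {..<n} \<and> card S = CARD('p)}"
  let ?h = "\<lambda>f :: 'p \<Rightarrow> nat. (\<Prod>k\<in>UNIV. w (f k)) * (cmod (det (\<chi> k. x (f k))))\<^sup>2"
  have fin: "finite ?F" by (intro finite_PiE) auto
  have noninj: "?h f = 0" if nf: "\<not> inj f" for f :: "'p \<Rightarrow> nat"
  proof -
    obtain a b where "a \<noteq> b" "f a = f b" using nf unfolding inj_def by auto
    then have "det (\<chi> k. x (f k)) = 0"
      by (intro det_identical_rows[of a b]) (auto simp: row_def)
    then show ?thesis by simp
  qed
  have "(\<Sum>f\<in>?F. ?h f) = (\<Sum>f | f \<in> ?F \<and> inj f. ?h f)"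
    using fin noninj by (intro sum.mono_neutral_right) auto
  also have "\<dots> = (\<Sum>S\<in>?K. \<Sum>f | f \<in> {f. f \<in> ?F \<and> inj f} \<and> range f = S. ?h f)"
    using fin by (intro sum.group[symmetric] finite_subsets_of_card) (auto simp: card_image)
  also have "\<dots> = (\<Sum>S\<in>?K. fact CARD('p) * (minor_weight x S * (\<Prod>i\<in>S. w i)))"
  proof (intro sum.cong refl)
    fix S assume S: "S \<in> ?K"
    have "{f. f \<in> {f. f \<in> ?F \<and> inj f} \<and> range f = S} = {f. inj f \<and> range f = S}"
      using S by auto
    moreover have "?h f = (\<Prod>i\<in>S. w i) * (cmod (det (\<chi> k. x (f k))))\<^sup>2"
      if "f \<in> {f. inj f \<and> range f = S}" for f
      using that prod.reindex[of f UNIV w] by auto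
    ultimately have "(\<Sum>f | f \<in> {f. f \<in> ?F \<and> inj f} \<and> range f = S. ?h f)
        = (\<Sum>f | inj f \<and> range f = S. (\<Prod>i\<in>S. w i) * (cmod (det (\<chi> k. x (f k))))\<^sup>2)"
      by (intro sum.cong)
    then show "(\<Sum>f | f \<in> {f. f \<in> ?F \<and> inj f} \<and> range f = S. ?h f)
        = fact CARD('p) * (minor_weight x S * (\<Prod>i\<in>S. w i))"
      by (simp add: minor_weight_def sum_distrib_left[symmetric])
  qed
  finally have "(\<Sum>f\<in>?F. ?h f) = fact CARD('p) * wsum (minor_weight x) CARD('p) {..<n} w"
    by (simp add: wsum_def sum_distrib_left)
  then have "fact CARD('p) * det (weighted_cov n x w)
      = fact CARD('p) * complex_of_real (wsum (minor_weight x) CARD('p) {..<n} w)"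
    unfolding det_weighted_cov_functions of_real_sum[symmetric] by simp
  then show ?thesis by simp
qed

text \<open>Any \<open>p\<close> samples with distinct indices are linearly independent. Injective
  functions on the index type list them as rows without choosing an order.\<close>

definition general_position :: "nat \<Rightarrow> (nat \<Rightarrow> complex^'p) \<Rightarrow> bool" where
  "general_position n x \<longleftrightarrow>
     (\<forall>f. inj f \<and> range f \<subseteq> {..<n} \<longrightarrow> det (\<chi> k::'p. x (f k)) \<noteq> 0)"

lemma ex_inj_onto_subset:
  assumes "finite S" "card S = CARD('p)"
  shows "\<exists>f::'p::finite \<Rightarrow> 'a. inj f \<and> range f = S"
  using finite_same_card_bij[of "UNIV :: 'p set" S] assms by (auto simp: bij_betw_def)

lemma minor_weight_pos:
  fixes x :: "nat \<Rightarrow> complex^'p"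
  assumes gp: "general_position n x" and S: "S \<subseteq> {..<n}" "card S = CARD('p)"
  shows "0 < minor_weight x S"
proof -
  have "finite S" using S finite_subset by blast
  then have "finite (PiE (UNIV :: 'p set) (\<lambda>_. S))" by (intro finite_PiE) auto
  then have "finite {f :: 'p \<Rightarrow> nat. inj f \<and> range f = S}"
    by (rule rev_finite_subset) auto
  moreover have "{f :: 'p \<Rightarrow> nat. inj f \<and> range f = S} \<noteq> {}"
    using ex_inj_onto_subset[OF \<open>finite S\<close> S(2)] by blast
  ultimately show ?thesis
    unfolding minor_weight_def using gp S(1)
    by (intro divide_pos_pos sum_pos) (auto simp: general_position_def)
qed

text \<open>As \<open>p \<le> n\<close>, the index \<open>i\<close> lies in some set of
  \<open>p\<close> indices, where a zero sample would be a zero row.\<close>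

lemma general_position_nonzero:
  fixes x :: "nat \<Rightarrow> complex^'p"
  assumes gp: "general_position n x" and n: "CARD('p) \<le> n" and i: "i < n"
  shows "x i \<noteq> 0"
proof
  assume xi: "x i = 0"
  have "CARD('p) - 1 \<le> card ({..<n} - {i})" using n i by simp
  then obtain U where U: "U \<subseteq> {..<n} - {i}" "card U = CARD('p) - 1"
    by (meson obtain_subset_with_card_n)
  then have "finite U" "i \<notin> U" using finite_subset by auto
  then have "card (insert i U) = CARD('p)" using U by simp
  then obtain f :: "'p \<Rightarrow> nat" where f: "inj f" "range f = insert i U"
    using ex_inj_onto_subset[of "insert i U"] \<open>finite U\<close> by auto
  then obtain k where "f k = i" by (metis insertI1 rangeE)
  then have "det (\<chi> k. x (f k)) = 0"
    using xi by (intro det_zero_row[of k]) (simp add: row_def vec_eq_iff)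
  then show False using gp f U i unfolding general_position_def by fastforce
qed

section \<open>Tyler fixed points in general position\<close>

text \<open>In general position this says that all leverages equal \<open>p / n\<close>; written
  through marginals it avoids the matrix inverse and fits the results on
  \<open>wsum\<close>.\<close>

definition balanced :: "nat \<Rightarrow> (nat \<Rightarrow> complex^'p) \<Rightarrow> (nat \<Rightarrow> real) \<Rightarrow> bool" where
  "balanced n x w \<longleftrightarrow> (\<forall>i<n. 0 < w i \<and>
     real n * wsum_at (minor_weight x) CARD('p) {..<n} w i
       = real CARD('p) * wsum (minor_weight x) CARD('p) {..<n} w)"

lemma weighted_cov_update:
  fixes x :: "nat \<Rightarrow> complex^'p"
  assumes "i < n"
  shows "weighted_cov n x (w(i := w i * (1 + s)))
    = weighted_cov n x w + cscale (complex_of_real (w i * s)) (outer (x i))"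
proof -
  have "weighted_cov n x (w(i := w i * (1 + s)))
      = (\<Sum>j<n. cscale (complex_of_real (w j)) (outer (x j))
          + (if j = i then cscale (complex_of_real (w i * s)) (outer (x i)) else 0))"
    unfolding weighted_cov_def
    by (intro sum.cong refl) (auto simp: cscale_def vec_eq_iff algebra_simps)
  then show ?thesis
    using assms by (simp add: sum.distrib weighted_cov_def)
qed

lemma wsum_minor_weight_pos:
  fixes x :: "nat \<Rightarrow> complex^'p"
  assumes "general_position n x" "CARD('p) \<le> n" "\<forall>i<n. 0 < w i"
  shows "0 < wsum (minor_weight x) CARD('p) {..<n} w"
  using assms by (intro wsum_pos minor_weight_pos) auto

lemma pd_weighted_cov_general_position:
  fixes x :: "nat \<Rightarrow> complex^'p"
  assumes "general_position n x" "CARD('p) \<le> n" "\<forall>i<n. 0 < w i"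
  shows "pd (weighted_cov n x w)"
  using wsum_minor_weight_pos[OF assms] assms(3)
  by (intro pd_weighted_cov) (auto simp: invertible_det_nz det_weighted_cov)

text \<open>Lowering the weight of \<open>x i\<close> by \<open>1 / q\<close> makes the matrix singular, and the determinant
  is affine in that weight.\<close>
lemma wsum_at_eq_leverage:
  fixes x :: "nat \<Rightarrow> complex^'p"
  assumes gp: "general_position n x" and n: "CARD('p) \<le> n" and w: "\<forall>i<n. 0 < w i"
    and i: "i < n"
    and q: "0 < q" "qform (matrix_inv (weighted_cov n x w)) (x i) = complex_of_real q"
  shows "wsum_at (minor_weight x) CARD('p) {..<n} w i
    = w i * q * wsum (minor_weight x) CARD('p) {..<n} w"
proof -
  \<comment> \<open>This \<open>?s\<close> lowers the coefficient of \<open>outer (x i)\<close> by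
    exactly \<open>1 / q\<close>. Both \<open>?A\<close> and \<open>1 / q\<close> times the outer
    product send \<open>?y\<close> to \<open>x i\<close>, so \<open>?y\<close> is in the kernel of
    the updated matrix.\<close>
  let ?A = "weighted_cov n x w" and ?s = "- (1 / (q * w i))"
  let ?y = "matrix_inv ?A *v x i"
  have wi: "0 < w i" using w i by simp
  have A: "pd ?A" by (intro pd_weighted_cov_general_position gp n w)
  have Ay: "?A *v ?y = x i" by (rule mult_matrix_inv_vec[OF invertible_pd[OF A]])
  have "w i * ?s = - (1 / q)" using wi q by (simp add: field_simps)
  then have upd: "weighted_cov n x (w(i := w i * (1 + ?s)))
      = ?A + cscale (complex_of_real (- (1 / q))) (outer (x i))"
    using weighted_cov_update[OF i, of x w ?s] by simp
  have "cdot (x i) ?y = complex_of_real q" using q by (simp add: qform_eq_cdot)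
  then have "weighted_cov n x (w(i := w i * (1 + ?s))) *v ?y = 0"
    unfolding upd matrix_vector_mult_add_rdistrib cscale_mult_vec outer_mult_vec Ay
    using q by (simp add: vec_eq_iff)
  moreover have "?y \<noteq> 0" using Ay general_position_nonzero[OF gp n i] by auto
  ultimately have "\<not> invertible (weighted_cov n x (w(i := w i * (1 + ?s))))"
    by (metis inj_matrix_vector_mult injD matrix_vector_mult_0_right)
  then have "wsum (minor_weight x) CARD('p) {..<n} (w(i := w i * (1 + ?s))) = 0"
    by (simp add: invertible_det_nz det_weighted_cov)
  then show ?thesis
    unfolding wsum_update[OF finite_lessThan] using wi q by (simp add: field_simps)
qed

text \<open>The \<open>n\<close> leverages add up to \<open>p\<close>, so if none exceeds
  \<open>p / n\<close>, none can fall below. A one-sided bound therefore suffices, which is what the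
  Loewner constraints provide.\<close>

lemma leverage_bound_imp_balanced:
  fixes x :: "nat \<Rightarrow> complex^'p"
  assumes gp: "general_position n x" and n: "CARD('p) \<le> n" and w: "\<forall>i<n. 0 < w i"
    and bound: "\<And>i q. i < n \<Longrightarrow> 0 < q \<Longrightarrow>
      qform (matrix_inv (weighted_cov n x w)) (x i) = complex_of_real q \<Longrightarrow>
      real n * (w i * q) \<le> real CARD('p)"
  shows "balanced n x w"
proof -
  let ?D = "wsum (minor_weight x) CARD('p) {..<n} w"
  let ?M = "wsum_at (minor_weight x) CARD('p) {..<n} w"
  have le: "real n * ?M i \<le> real CARD('p) * ?D" if i: "i < n" for i
  proof -
    obtain q where q: "0 < q" "qform (matrix_inv (weighted_cov n x w)) (x i) = complex_of_real q"
      using qform_matrix_inv_pos[OF pd_weighted_cov_general_position[OF gp n w]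
          general_position_nonzero[OF gp n i]] by blast
    have "real n * (w i * q) * ?D \<le> real CARD('p) * ?D"
      using bound[OF i q] wsum_minor_weight_pos[OF gp n w] by (intro mult_right_mono) auto
    then show ?thesis using wsum_at_eq_leverage[OF gp n w i q] by (simp add: mult_ac)
  qed
  have "(\<Sum>i<n. real CARD('p) * ?D - real n * ?M i) = 0"
    by (simp add: sum_subtractf sum_wsum_at flip: sum_distrib_left)
  then have "real CARD('p) * ?D - real n * ?M i = 0" if "i < n" for i
    using le that by (subst (asm) sum_nonneg_eq_0_iff) auto
  then show ?thesis using w by (simp add: balanced_def)
qed

lemma balanced_leverage:
  fixes x :: "nat \<Rightarrow> complex^'p"
  assumes gp: "general_position n x" and n: "CARD('p) \<le> n" and bal: "balanced n x w"
    and i: "i < n"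
    and q: "0 < q" "qform (matrix_inv (weighted_cov n x w)) (x i) = complex_of_real q"
  shows "real n * (w i * q) = real CARD('p)"
proof -
  let ?D = "wsum (minor_weight x) CARD('p) {..<n} w"
  have w: "\<forall>i<n. 0 < w i" using bal by (simp add: balanced_def)
  have "real n * wsum_at (minor_weight x) CARD('p) {..<n} w i = real CARD('p) * ?D"
    using bal i by (simp add: balanced_def)
  then have "real n * (w i * q * ?D) = real CARD('p) * ?D"
    by (simp only: wsum_at_eq_leverage[OF gp n w i q])
  moreover have "0 < ?D" by (rule wsum_minor_weight_pos[OF gp n w])
  ultimately show ?thesis by (simp add: mult.assoc[symmetric])
qed

lemma balanced_imp_tyler_fixed_point:
  fixes x :: "nat \<Rightarrow> complex^'p"
  assumes gp: "general_position n x" and n: "CARD('p) \<le> n" and bal: "balanced n x w"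
  shows "tyler_fixed_point n x (weighted_cov n x w)"
proof -
  let ?A = "weighted_cov n x w"
  have w: "\<forall>i<n. 0 < w i" using bal by (simp add: balanced_def)
  have A: "pd ?A" by (rule pd_weighted_cov_general_position[OF gp n w])
  have coeff: "complex_of_real (w i)
      = complex_of_real (real CARD('p) / real n) * (1 / qform (matrix_inv ?A) (x i))" if i: "i < n" for i
  proof -
    obtain q where q: "0 < q" "qform (matrix_inv ?A) (x i) = complex_of_real q"
      using qform_matrix_inv_pos[OF A general_position_nonzero[OF gp n i]] by blast
    have "w i = real CARD('p) / real n * (1 / q)"
      using balanced_leverage[OF gp n bal i q] q i by (simp add: field_simps)
    then show ?thesis unfolding q(2) by (metis of_real_1 of_real_divide of_real_mult)
  qed
  have "?A = cscale (complex_of_real (real CARD('p) / real n))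
      (\<Sum>i<n. cscale (1 / qform (matrix_inv ?A) (x i)) (outer (x i)))" (is "_ = ?R")
  proof -
    have "?A $ k $ l = ?R $ k $ l" for k l
      unfolding weighted_cov_nth
      by (simp add: coeff cscale_def outer_def sum_distrib_left mult.assoc)
    then show ?thesis by (simp add: vec_eq_iff)
  qed
  then show ?thesis using A by (simp add: tyler_fixed_point_def)
qed

text \<open>The weights are the coefficients on the right-hand side of the fixed-point equation, so
  each leverage is \<open>p / n\<close> by construction.\<close>

lemma tyler_fixed_point_imp_balanced:
  fixes x :: "nat \<Rightarrow> complex^'p"
  assumes gp: "general_position n x" and n: "CARD('p) \<le> n"
    and T: "tyler_fixed_point n x \<Theta>"
  obtains w where "balanced n x w" "\<Theta> = weighted_cov n x w"
proof
  have A: "pd \<Theta>" using T by (simp add: tyler_fixed_point_def)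
  define w where "w i = real CARD('p) / real n * (1 / Re (qform (matrix_inv \<Theta>) (x i)))" for i
  have q: "0 < Re (qform (matrix_inv \<Theta>) (x i))"
      "qform (matrix_inv \<Theta>) (x i) = complex_of_real (Re (qform (matrix_inv \<Theta>) (x i)))" if i: "i < n" for i
    using qform_matrix_inv_pos[OF A general_position_nonzero[OF gp n i]] by (metis Re_complex_of_real)+
  have coeff: "complex_of_real (w i)
      = complex_of_real (real CARD('p) / real n) * (1 / qform (matrix_inv \<Theta>) (x i))" if "i < n" for i
    unfolding w_def by (subst q(2)[OF that]) simp
  have "\<Theta> $ k $ l = weighted_cov n x w $ k $ l" for k l
  proof -
    have "\<Theta> = cscale (complex_of_real (real CARD('p) / real n))
        (\<Sum>i<n. cscale (1 / qform (matrix_inv \<Theta>) (x i)) (outer (x i)))"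
      using T by (simp add: tyler_fixed_point_def)
    then have "\<Theta> $ k $ l = cscale (complex_of_real (real CARD('p) / real n))
        (\<Sum>i<n. cscale (1 / qform (matrix_inv \<Theta>) (x i)) (outer (x i))) $ k $ l" by metis
    then show ?thesis
      unfolding weighted_cov_nth
      by (simp add: coeff cscale_def outer_def sum_distrib_left mult.assoc)
  qed
  then show eq: "\<Theta> = weighted_cov n x w" by (simp add: vec_eq_iff)
  have w: "\<forall>i<n. 0 < w i"
    unfolding w_def using q by simp
  show "balanced n x w"
  proof (rule leverage_bound_imp_balanced[OF gp n w])
    fix i r
    assume i: "i < n" and r: "0 < r" "qform (matrix_inv (weighted_cov n x w)) (x i) = complex_of_real r"
    have "Re (qform (matrix_inv \<Theta>) (x i)) = r" using r eq by (metis Re_complex_of_real)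
    then show "real n * (w i * r) \<le> real CARD('p)" unfolding w_def using r i by simp
  qed
qed

lemma balanced_scale: "balanced n x w \<Longrightarrow> 0 < a \<Longrightarrow> balanced n x (\<lambda>i. a * w i)"
  by (simp add: balanced_def wsum_scale wsum_at_scale mult.left_commute)

lemma ex_balanced:
  fixes x :: "nat \<Rightarrow> complex^'p"
  assumes "general_position n x" "CARD('p) < n"
  shows "\<exists>w. balanced n x w"
  using ex_equal_marginals[of "{..<n}" "CARD('p)" "minor_weight x"] minor_weight_pos[OF assms(1)] assms(2)
  by (auto simp: balanced_def)

lemma balanced_unique:
  fixes x :: "nat \<Rightarrow> complex^'p"
  assumes gp: "general_position n x" and n: "CARD('p) < n"
    and "balanced n x w" "balanced n x v"
  shows "\<exists>a>0. weighted_cov n x v = a *\<^sub>R weighted_cov n x w"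
proof -
  have "\<exists>a>0. \<forall>i\<in>{..<n}. v i = a * w i"
    using assms by (intro equal_marginals_unique[where c = "minor_weight x" and p = "CARD('p)"])
      (auto simp: balanced_def minor_weight_pos)
  then obtain a where a: "0 < a" "\<And>i. i < n \<Longrightarrow> v i = a * w i" by auto
  then have "weighted_cov n x v = a *\<^sub>R weighted_cov n x w"
    by (simp add: weighted_cov_scale[symmetric] cong: weighted_cov_cong)
  with a show ?thesis by blast
qed

section \<open>Minimizers of the COCA program\<close>

lemma trace_weighted_cov:
  "trace (weighted_cov n x w) = complex_of_real (\<Sum>i<n. w i * (norm (x i))\<^sup>2)"
proof -
  have "trace (weighted_cov n x w) = (\<Sum>i<n. complex_of_real (w i) * cdot (x i) (x i))"
    unfolding trace_def weighted_cov_nth cdot_def sum_distrib_left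
    by (subst sum.swap) (simp add: mult_ac)
  then show ?thesis by (simp add: cdot_self)
qed

lemma coca_objective_eq:
  "coca_objective N n x \<Theta> d = N (\<Theta> - weighted_cov n x (\<lambda>i. d i / real n))"
proof -
  have "cscale (complex_of_real (1 / real n)) (\<Sum>i<n. cscale (complex_of_real (d i)) (outer (x i)))
      = weighted_cov n x (\<lambda>i. d i / real n)"
    by (simp add: vec_eq_iff weighted_cov_nth) (simp add: cscale_def outer_def sum_distrib_left mult_ac)
  then show ?thesis by (simp add: coca_objective_def)
qed

text \<open>Balanced weights are scaled to trace \<open>p\<close>, and \<open>d i = n * w i\<close>.
  Leverages equal to \<open>p / n\<close> turn the scalar criterion for each Loewner constraint into
  an equality.\<close>

lemma ex_coca_feasible_zero:
  fixes x :: "nat \<Rightarrow> complex^'p"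
  assumes gp: "general_position n x" and n: "CARD('p) < n"
  shows "\<exists>\<Theta> d. coca_feasible n x \<Theta> d \<and> \<Theta> = weighted_cov n x (\<lambda>i. d i / real n)"
proof -
  have n': "CARD('p) \<le> n" "0 < n" using n by auto
  obtain v where v: "balanced n x v" using ex_balanced[OF gp n] by blast
  define \<tau> where "\<tau> = (\<Sum>i<n. v i * (norm (x i))\<^sup>2)"
  have \<tau>: "0 < \<tau>"
    unfolding \<tau>_def using v general_position_nonzero[OF gp n'(1)] n'(2)
    by (intro sum_pos) (auto simp: balanced_def)
  define w where "w i = real CARD('p) / \<tau> * v i" for i
  have bal: "balanced n x w" unfolding w_def using \<tau> by (intro balanced_scale v) auto
  then have w: "\<forall>i<n. 0 < w i" by (simp add: balanced_def)
  let ?A = "weighted_cov n x w"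
  have A: "pd ?A" by (rule pd_weighted_cov_general_position[OF gp n'(1) w])
  have "trace ?A = of_nat CARD('p)"
  proof -
    have "(\<Sum>i<n. w i * (norm (x i))\<^sup>2) = real CARD('p) / \<tau> * \<tau>"
      by (subst (2) \<tau>_def) (simp add: w_def sum_distrib_left mult_ac)
    then show ?thesis using \<tau> by (simp add: trace_weighted_cov)
  qed
  moreover have "psd ?A"
    unfolding psd_def
  proof (intro conjI allI hermitian_weighted_cov)
    show "0 \<le> Re (qform ?A u)" for u
      using A unfolding pd_def by (cases "u = 0") (auto simp: qform_eq_cdot less_imp_le)
  qed
  moreover have "loewner_ge ?A (cscale (complex_of_real (real n * w i / real CARD('p))) (outer (x i)))"
    if i: "i < n" for i
  proof -
    obtain q where q: "0 < q" "qform (matrix_inv ?A) (x i) = complex_of_real q"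
      using qform_matrix_inv_pos[OF A general_position_nonzero[OF gp n'(1) i]] by blast
    show ?thesis
      unfolding loewner_ge_outer_iff[OF A q]
      using balanced_leverage[OF gp n'(1) bal i q] by (simp add: mult_ac)
  qed
  ultimately have "coca_feasible n x ?A (\<lambda>i. real n * w i)"
    using w n'(2) by (simp add: coca_feasible_def S_unstruct_def)
  moreover have "?A = weighted_cov n x (\<lambda>i. real n * w i / real n)"
    using n'(2) by simp
  ultimately show ?thesis by blast
qed

text \<open>With weights \<open>d i / n\<close>, the scalar form \<open>d i / p * q \<le> 1\<close>
  of a constraint is the upper bound \<open>p / n\<close> on a leverage.\<close>

lemma coca_feasible_zero_balanced:
  fixes x :: "nat \<Rightarrow> complex^'p"
  assumes gp: "general_position n x" and n: "CARD('p) \<le> n"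
    and feas: "coca_feasible n x \<Theta> d" and zero: "\<Theta> = weighted_cov n x (\<lambda>i. d i / real n)"
  shows "balanced n x (\<lambda>i. d i / real n)"
proof -
  have w: "\<forall>i<n. 0 < d i / real n"
    using feas by (simp add: coca_feasible_def)
  note A = pd_weighted_cov_general_position[OF gp n w]
  show ?thesis
  proof (rule leverage_bound_imp_balanced[OF gp n w])
    fix i q
    assume i: "i < n"
      and q: "0 < q" "qform (matrix_inv (weighted_cov n x (\<lambda>i. d i / real n))) (x i) = complex_of_real q"
    have "loewner_ge (weighted_cov n x (\<lambda>i. d i / real n))
        (cscale (complex_of_real (d i / real CARD('p))) (outer (x i)))"
      using feas i zero by (simp add: coca_feasible_def)
    then have "d i / real CARD('p) * q \<le> 1"
      using loewner_ge_outer_iff[OF A q] by blast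
    then show "real n * (d i / real n * q) \<le> real CARD('p)"
      using i by (simp add: field_simps)
  qed
qed

text \<open>The value zero is attained, so minimizers are the feasible points with zero residual.
  Here the dependence on the norm disappears.\<close>

lemma coca_minimizer_iff:
  fixes x :: "nat \<Rightarrow> complex^'p"
  assumes gp: "general_position n x" and n: "CARD('p) < n" and N: "is_matrix_norm N"
  shows "coca_minimizer N n x \<Theta> d
    \<longleftrightarrow> coca_feasible n x \<Theta> d \<and> \<Theta> = weighted_cov n x (\<lambda>i. d i / real n)"
proof -
  have N0: "0 \<le> N B" "N B = 0 \<longleftrightarrow> B = 0" for B using N by (auto simp: is_matrix_norm_def)
  obtain \<Theta>1 d1 where "coca_feasible n x \<Theta>1 d1" "\<Theta>1 = weighted_cov n x (\<lambda>i. d1 i / real n)"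
    using ex_coca_feasible_zero[OF gp n] by blast
  then have "coca_feasible n x \<Theta>1 d1" "coca_objective N n x \<Theta>1 d1 = 0"
    using N0(2)[of 0] by (simp_all add: coca_objective_eq)
  then have "coca_minimizer N n x \<Theta> d
      \<longleftrightarrow> coca_feasible n x \<Theta> d \<and> coca_objective N n x \<Theta> d = 0"
    unfolding coca_minimizer_def by (metis N0(1) coca_objective_eq order_antisym)
  then show ?thesis by (simp add: coca_objective_eq N0(2))
qed

lemma coca_eq_tyler_general_position:
  fixes x :: "nat \<Rightarrow> complex^'p"
  assumes gp: "general_position n x" and n: "CARD('p) < n" and N: "is_matrix_norm N"
  shows "(\<exists>\<Theta> d. coca_minimizer N n x \<Theta> d) \<and>
    (\<forall>\<Theta> d. coca_minimizer N n x \<Theta> d \<longrightarrow> tyler_fixed_point n x \<Theta> \<and>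
      (\<forall>\<Theta>'. tyler_fixed_point n x \<Theta>' \<longrightarrow> (\<exists>c>0. \<Theta>' = c *\<^sub>R \<Theta>)))"
proof (intro conjI allI impI)
  have n': "CARD('p) \<le> n" using n by simp
  show "\<exists>\<Theta> d. coca_minimizer N n x \<Theta> d"
    using ex_coca_feasible_zero[OF gp n] coca_minimizer_iff[OF gp n N] by metis
  fix \<Theta> d assume "coca_minimizer N n x \<Theta> d"
  then have feas: "coca_feasible n x \<Theta> d"
    and \<Theta>: "\<Theta> = weighted_cov n x (\<lambda>i. d i / real n)"
    using coca_minimizer_iff[OF gp n N] by metis+
  have bal: "balanced n x (\<lambda>i. d i / real n)"
    by (rule coca_feasible_zero_balanced[OF gp n' feas \<Theta>])
  then show "tyler_fixed_point n x \<Theta>"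
    using balanced_imp_tyler_fixed_point[OF gp n'] \<Theta> by metis
  fix \<Theta>' assume "tyler_fixed_point n x \<Theta>'"
  then obtain v where "balanced n x v" "\<Theta>' = weighted_cov n x v"
    by (rule tyler_fixed_point_imp_balanced[OF gp n'])
  then show "\<exists>c>0. \<Theta>' = c *\<^sub>R \<Theta>"
    using balanced_unique[OF gp n bal] \<Theta> by metis
qed

section \<open>General position of the samples\<close>

text \<open>Fewer than \<open>p\<close> homogeneous equations have a nonzero solution: padding with
  zero rows gives a singular square matrix.\<close>

lemma orthogonal_vector_exists:
  fixes b :: "'p::finite \<Rightarrow> complex^'p"
  assumes "S \<noteq> UNIV"
  shows "\<exists>v. v \<noteq> 0 \<and> (\<forall>k\<in>S. cdot (b k) v = 0)"
proof -
  obtain k0 where k0: "k0 \<notin> S" using assms by auto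
  define B :: "complex^'p^'p" where "B = (\<chi> k j. if k \<in> S then cnj (b k $ j) else 0)"
  have "det B = 0" using k0 by (intro det_zero_row[of k0]) (simp add: row_def B_def vec_eq_iff)
  then have "\<not> invertible B" by (simp add: invertible_det_nz)
  then obtain v where v: "v \<noteq> 0" "B *v v = 0"
    by (metis invertible_left_inverse matrix_left_invertible_ker)
  have "cdot (b k) v = 0" if "k \<in> S" for k
  proof -
    have "(B *v v) $ k = 0" using v by simp
    then show ?thesis using that by (simp add: matrix_vector_mult_def B_def cdot_def)
  qed
  then show ?thesis using v by blast
qed

text \<open>Gram-Schmidt for the inner product of \<open>A\<close>: each new vector is taken
  orthogonal to the previous ones and normalised.\<close>

lemma ex_orthonormal_family:
  fixes A :: "complex^'p^'p"
  assumes A: "pd A" and "finite S"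
  shows "\<exists>b :: 'p \<Rightarrow> complex^'p. \<forall>j\<in>S. \<forall>k\<in>S. cdot (b j) (A *v b k) = (if j = k then 1 else 0)"
  using \<open>finite S\<close>
proof (induction S rule: finite_induct)
  case (insert l S)
  then obtain b :: "'p \<Rightarrow> complex^'p" where
    b: "\<And>j k. j \<in> S \<Longrightarrow> k \<in> S \<Longrightarrow> cdot (b j) (A *v b k) = (if j = k then 1 else 0)" by blast
  have "S \<noteq> UNIV" using insert.hyps by auto
  then obtain v where v: "v \<noteq> 0" "\<And>k. k \<in> S \<Longrightarrow> cdot (A *v b k) v = 0"
    using orthogonal_vector_exists[of S "\<lambda>k. A *v b k"] by blast
  define r where "r = Re (qform A v)"
  have r: "0 < r" using A v by (simp add: r_def pd_def)
  have vv: "cdot v (A *v v) = complex_of_real r"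
    using hermitian_qform_real[OF hermitian_pd[OF A], of v] by (simp add: qform_eq_cdot r_def)
  have bv: "cdot (b k) (A *v v) = 0" "cdot v (A *v b k) = 0" if "k \<in> S" for k
    using v(2)[OF that] hermitian_cdot[OF hermitian_pd[OF A], of "b k" v]
      cnj_cdot[of "A *v b k" v] by auto
  define c where "c = complex_of_real (1 / sqrt r)"
  have "cnj c * c * complex_of_real r = complex_of_real (1 / sqrt r * (1 / sqrt r) * r)"
    unfolding c_def by (simp only: complex_cnj_complex_of_real of_real_mult)
  also have "1 / sqrt r * (1 / sqrt r) * r = 1" using r by (simp add: field_simps)
  finally have c: "c * (cnj c * complex_of_real r) = 1" by (simp add: mult_ac)
  have "\<forall>j\<in>insert l S. \<forall>k\<in>insert l S.
      cdot ((b(l := c *s v)) j) (A *v (b(l := c *s v)) k) = (if j = k then 1 else 0)"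
    using insert.hyps(2) b bv vv c
    by (auto simp: vector_scalar_commute cdot_smult_left cdot_smult_right)
  then show ?case by blast
qed simp

text \<open>Since \<open>angular_elliptical\<close> selects its factor by \<open>SOME\<close>, one
  has to exist. If the columns of \<open>B\<close> are orthonormal for \<open>A\<close>, then
  \<open>B B\<^sup>H\<close> is the inverse of \<open>A\<close>, and \<open>A B\<close> is a
  factor.\<close>

lemma ex_cadj_factor:
  fixes A :: "complex^'p^'p"
  assumes A: "pd A"
  shows "\<exists>\<Lambda> :: complex^'p^'p. \<Lambda> ** cadj \<Lambda> = A"
proof -
  obtain b :: "'p \<Rightarrow> complex^'p" where
    b: "\<And>j k. cdot (b j) (A *v b k) = (if j = k then 1 else 0)"
    using ex_orthonormal_family[OF A, of UNIV] by auto
  define B :: "complex^'p^'p" where "B = (\<chi> i j. b j $ i)"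
  have cadj_mult: "cadj (X ** Y) = cadj Y ** cadj X" for X Y :: "complex^'p^'p"
    by (simp add: cadj_def matrix_matrix_mult_def vec_eq_iff mult.commute)
  have cadj_one: "cadj (mat 1 :: complex^'p^'p) = mat 1"
    by (simp add: cadj_def mat_def vec_eq_iff)
  have "(cadj B ** A ** B) $ j $ k = cdot (b j) (A *v b k)" for j k
    unfolding matrix_mul_assoc[symmetric]
    by (simp add: cdot_def cadj_def B_def matrix_matrix_mult_def matrix_vector_mult_def)
  then have one: "cadj B ** A ** B = mat 1" by (simp add: vec_eq_iff b mat_def)
  then have "B ** (cadj B ** A) = mat 1" by (simp add: matrix_left_right_inverse)
  then have B: "B ** cadj B ** A = mat 1" by (simp add: matrix_mul_assoc)
  then have inv: "A ** (B ** cadj B) = mat 1" by (simp add: matrix_left_right_inverse)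
  have "A ** B ** cadj (A ** B) = A ** B ** cadj B ** cadj A"
    by (simp add: cadj_mult matrix_mul_assoc)
  also have "\<dots> = cadj A" using inv by (simp add: matrix_mul_assoc)
  also have "\<dots> = A" using hermitian_pd[OF A] by (simp add: hermitian_def)
  finally show ?thesis by blast
qed

text \<open>A complex hyperplane lies in a real one, which is Lebesgue null; being closed, it is a
  Borel set.\<close>

lemma null_complex_hyperplane:
  fixes a :: "complex^'p"
  assumes "a \<noteq> 0"
  shows "{y. cdot a y = 0} \<in> null_sets lborel"
proof -
  have "cdot a y = 0 \<Longrightarrow> a \<bullet> y = 0" for y
  proof -
    have "a \<bullet> y = Re (cdot a y)" by (simp add: inner_vec_def cdot_def inner_complex_def)
    then show "cdot a y = 0 \<Longrightarrow> a \<bullet> y = 0" by simp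
  qed
  then have "negligible {y. cdot a y = 0}"
    using assms by (intro negligible_subset[OF negligible_hyperplane[of a 0]]) auto
  moreover have "closed {y. cdot a y = 0}"
    unfolding cdot_def by (intro closed_Collect_eq continuous_intros)
  ultimately show ?thesis
    by (simp add: negligible_iff_null_sets null_sets_completion_iff borel_closed)
qed

lemma measurable_cdot: "cdot a \<in> borel_measurable borel"
  unfolding cdot_def[abs_def] by (intro borel_measurable_continuous_onI continuous_intros)

text \<open>Normalising a vector does not affect whether \<open>cdot a\<close> vanishes on it. The
  claim thus pulls back along \<Lambda> to the null hyperplane of \<open>cadj \<Lambda> *v a\<close>
  in the unit ball.\<close>

lemma AE_angular_elliptical:
  fixes \<Theta>0 :: "complex^'p^'p"
  assumes "pd \<Theta>0" and a: "a \<noteq> 0"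
  shows "AE y in angular_elliptical \<Theta>0. cdot a y \<noteq> 0"
proof -
  define \<Lambda> :: "complex^'p^'p" where "\<Lambda> = (SOME \<Lambda>. \<Lambda> ** cadj \<Lambda> = \<Theta>0)"
  have \<Lambda>: "\<Lambda> ** cadj \<Lambda> = \<Theta>0"
    unfolding \<Lambda>_def by (rule someI_ex[OF ex_cadj_factor[OF assms(1)]])
  have "\<Lambda> ** (cadj \<Lambda> ** matrix_inv \<Theta>0) = mat 1"
    using matrix_inv_mult(1)[OF invertible_pd[OF assms(1)]] by (simp add: matrix_mul_assoc \<Lambda>)
  then have "invertible \<Lambda>" by (metis invertible_right_inverse)
  have "cadj \<Lambda> *v a \<noteq> 0"
  proof
    assume "cadj \<Lambda> *v a = 0"
    then have "\<Theta>0 *v a = 0" by (simp add: \<Lambda>[symmetric] matrix_vector_mul_assoc[symmetric])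
    then show False
      using a inj_matrix_vector_mult[OF invertible_pd[OF assms(1)]]
      by (metis injD matrix_vector_mult_0_right)
  qed
  then have null: "AE y in lborel. cdot (cadj \<Lambda> *v a) y \<noteq> 0"
    by (intro AE_I'[OF null_complex_hyperplane]) auto
  have lin: "cdot a (\<Lambda> *v y) = cdot (cadj \<Lambda> *v a) y" for y by (rule cdot_cadj)
  have scale: "cdot u (r *\<^sub>R y) = r *\<^sub>R cdot u y" for u y :: "complex^'p" and r
    by (simp add: cdot_def scaleR_sum_right)
  have cont: "continuous_on UNIV ((*v) \<Lambda>)" by (simp add: linear_continuous_on)
  have m1: "(\<lambda>y. (1 / norm y) *\<^sub>R y) \<in> borel_measurable (borel :: (complex^'p) measure)" by measurable
  have m\<Lambda>: "((*v) \<Lambda>) \<in> borel_measurable borel"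
    by (intro borel_measurable_continuous_onI cont)
  have m2: "(\<lambda>u. (1 / norm (\<Lambda> *v u)) *\<^sub>R (\<Lambda> *v u)) \<in> borel_measurable borel"
    using measurable_compose[OF m\<Lambda> m1] by simp
  have sets: "{y. cdot u y \<noteq> 0} \<in> sets borel" for u :: "complex^'p"
    using measurable_cdot[of u] by measurable
  have "AE y in uniform_measure lborel (ball 0 1 :: (complex^'p) set). cdot (cadj \<Lambda> *v a) y \<noteq> 0"
    by (intro AE_uniform_measureI) (use null in auto)
  moreover have "cdot (cadj \<Lambda> *v a) ((1 / norm y) *\<^sub>R y) \<noteq> 0"
    if "cdot (cadj \<Lambda> *v a) y \<noteq> 0" for y
    using that by (auto simp: scale)
  ultimately have "AE y in uniform_csphere. cdot (cadj \<Lambda> *v a) y \<noteq> 0"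
    unfolding uniform_csphere_def using sets[of "cadj \<Lambda> *v a"] m1
    by (subst AE_distr_iff) (auto elim: eventually_mono)
  moreover have "cdot a ((1 / norm (\<Lambda> *v y)) *\<^sub>R (\<Lambda> *v y)) \<noteq> 0"
    if "cdot (cadj \<Lambda> *v a) y \<noteq> 0" for y
    using that lin[of y] by (auto simp: scale)
  ultimately show ?thesis
    unfolding angular_elliptical_def \<Lambda>_def[symmetric] Let_def
    using sets[of a] m2
    by (subst AE_distr_iff) (auto elim: eventually_mono simp: uniform_csphere_def)
qed

section \<open>From a single sample to independent samples\<close>

lemma (in prob_space) AE_indep_cdot_nonzero:
  fixes U V :: "'a \<Rightarrow> complex^'p"
  assumes indep: "indep_var borel U borel V"
    and V: "\<And>a. a \<noteq> 0 \<Longrightarrow> AE y in distr M borel V. cdot a y \<noteq> 0"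
    and U: "AE w in M. U w \<noteq> 0"
  shows "AE w in M. cdot (U w) (V w) \<noteq> 0"
proof -
  have rv: "random_variable borel U" "random_variable borel V"
    using indep indep_var_rv1 indep_var_rv2 by blast+
  interpret PU: prob_space "distr M borel U" by (rule prob_space_distr[OF rv(1)])
  interpret PV: prob_space "distr M borel V" by (rule prob_space_distr[OF rv(2)])
  interpret pair_sigma_finite "distr M borel U" "distr M borel V" ..
  have meas: "(\<lambda>p. cdot (fst p) (snd p)) \<in> borel_measurable (borel \<Otimes>\<^sub>M borel :: ((complex^'p) \<times> (complex^'p)) measure)"
    unfolding borel_prod cdot_def by (intro borel_measurable_continuous_onI continuous_intros)
  then have sets: "{p \<in> space (borel \<Otimes>\<^sub>M borel). cdot (fst p) (snd p) \<noteq> (0::complex)} \<in> sets (borel \<Otimes>\<^sub>M borel :: ((complex^'p) \<times> (complex^'p)) measure)"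
    by measurable
  have "AE a in distr M borel U. a \<noteq> 0"
    using U rv by (subst AE_distr_iff) auto
  then have "AE a in distr M borel U. AE y in distr M borel V. cdot a y \<noteq> 0"
    using V by (auto elim: eventually_mono)
  \<comment> \<open>Fubini: for each fixed nonzero value of \<open>U\<close>, almost every value of
    \<open>V\<close> avoids its hyperplane. By independence this product measure is the joint
    law.\<close>
  then have "AE p in distr M borel U \<Otimes>\<^sub>M distr M borel V. cdot (fst p) (snd p) \<noteq> 0"
    using sets by (intro AE_pair_measure) (auto simp: space_pair_measure cong: sets_pair_measure_cong)
  also have "distr M borel U \<Otimes>\<^sub>M distr M borel V = distr M (borel \<Otimes>\<^sub>M borel) (\<lambda>w. (U w, V w))"
    using indep by (simp add: indep_var_distribution_eq)
  finally show ?thesis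
    using sets rv by (subst (asm) AE_distr_iff) auto
qed

lemma borel_measurable_det:
  fixes X :: "'a \<Rightarrow> complex^'p^'p"
  assumes "\<And>i j. (\<lambda>w. X w $ i $ j) \<in> borel_measurable M"
  shows "(\<lambda>w. det (X w)) \<in> borel_measurable M"
  unfolding det_def using assms by measurable

lemma borel_measurable_vec_lambda:
  fixes g :: "'a \<Rightarrow> 'p::finite \<Rightarrow> complex"
  assumes "\<And>j. (\<lambda>w. g w j) \<in> borel_measurable M"
  shows "(\<lambda>w. \<chi> j. g w j) \<in> borel_measurable M"
proof (subst borel_measurable_euclidean_space, intro ballI)
  fix b :: "complex^'p" assume "b \<in> Basis"
  have "(\<lambda>w. \<Sum>j\<in>UNIV. g w j \<bullet> b $ j) \<in> borel_measurable M" using assms by measurable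
  then show "(\<lambda>w. (\<chi> j. g w j) \<bullet> b) \<in> borel_measurable M" by (simp add: inner_vec_def)
qed

text \<open>Laplace expansion along row \<open>k\<close>, each cofactor being a determinant with a
  unit vector in that row. The conjugates compensate for \<open>cdot\<close> being conjugate-linear
  in its first argument.\<close>

lemma det_row_expansion:
  fixes r :: "'p::finite \<Rightarrow> complex^'p"
  shows "det (\<chi> i. if i = k then v else r i)
    = cdot (\<chi> j. cnj (det (\<chi> i. if i = k then axis j 1 else r i))) v"
proof -
  have v: "v = (\<Sum>j\<in>UNIV. v $ j *s axis j 1)"
    by (simp add: vec_eq_iff axis_def if_distrib cong: if_cong)
  have "det (\<chi> i. if i = k then v else r i)
      = (\<Sum>j\<in>UNIV. det (\<chi> i. if i = k then v $ j *s axis j 1 else r i))"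
    by (subst v) (rule det_linear_row_sum[OF finite, where a = "\<lambda>_ j. v $ j *s axis j 1"])
  then show ?thesis
    by (simp add: det_row_mul cdot_def mult.commute)
qed

text \<open>The rows are made random one at a time: expanding along the new row, whose cofactors are
  independent of it, the cofactor on the diagonal is the previous determinant.\<close>
lemma (in prob_space) AE_det_indep_rows:
  fixes x :: "nat \<Rightarrow> 'a \<Rightarrow> complex^'p" and f :: "'p \<Rightarrow> nat"
  assumes indep: "indep_vars (\<lambda>_. borel) x I" and f: "inj f" "range f \<subseteq> I"
    and hyp: "\<And>i a. i \<in> I \<Longrightarrow> a \<noteq> 0 \<Longrightarrow> AE y in distr M borel (x i). cdot a y \<noteq> 0"
    and "finite S"
  shows "AE w in M. det (\<chi> i. if i \<in> S then x (f i) w else axis i 1) \<noteq> 0"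
  using \<open>finite S\<close>
proof (induction S rule: finite_induct)
  case empty
  \<comment> \<open>Rows not yet made random are unit vectors, so the induction starts at the
    identity matrix.\<close>
  have "(\<chi> i. axis i 1) = (mat 1 :: complex^'p^'p)"
    by (simp add: vec_eq_iff mat_def axis_def eq_commute)
  then show ?case by simp
next
  case (insert k S)
  define row where "row z i = (if i \<in> S then z (f i) else axis i 1 :: complex^'p)"
    for z :: "nat \<Rightarrow> complex^'p" and i
  define g where "g z = (\<chi> j. cnj (det (\<chi> i. if i = k then axis j 1 else row z i)))"
    for z :: "nat \<Rightarrow> complex^'p"
  have fk: "f k \<notin> f ` S" using f(1) insert.hyps(2) by (auto simp: inj_def)
  have "(\<lambda>z. z (f i) $ j) \<in> borel_measurable (PiM (f ` S) (\<lambda>_. borel :: (complex^'p) measure))"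
    if "i \<in> S" for i j
  proof -
    have "(\<lambda>v :: complex^'p. v $ j) \<in> borel_measurable borel"
      by (intro borel_measurable_continuous_onI continuous_intros)
    then show ?thesis using that by (intro measurable_compose[OF measurable_component_singleton]) auto
  qed
  then have row_meas: "(\<lambda>z. row z i $ j) \<in> borel_measurable (PiM (f ` S) (\<lambda>_. borel :: (complex^'p) measure))" for i j
    unfolding row_def by (cases "i \<in> S") auto
  have "(\<lambda>z. (\<chi> i. if i = k then axis j 1 else row z i) $ i1 $ i2)
      \<in> borel_measurable (PiM (f ` S) (\<lambda>_. borel :: (complex^'p) measure))" for j i1 i2
    using row_meas by (cases "i1 = k") auto
  moreover have "cnj \<in> borel_measurable borel"
    by (intro borel_measurable_continuous_onI continuous_intros)
  ultimately have g_meas: "g \<in> borel_measurable (PiM (f ` S) (\<lambda>_. borel))"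
    unfolding g_def[abs_def]
    by (intro borel_measurable_vec_lambda measurable_compose[OF borel_measurable_det, of _ _ cnj])
  \<comment> \<open>The cofactor vector \<open>g\<close> only sees samples with index in the image
    of \<open>S\<close> under \<open>f\<close>. By injectivity \<open>f k\<close> lies outside this
    block, so the new row is independent of it.\<close>
  have "indep_var borel (g \<circ> (\<lambda>w. restrict (\<lambda>i. x i w) (f ` S)))
      borel ((\<lambda>z. z (f k)) \<circ> (\<lambda>w. restrict (\<lambda>i. x i w) {f k}))"
    using fk f(2) by (intro indep_var_compose[OF indep_var_restrict[OF indep] g_meas]) auto
  moreover have "g (restrict (\<lambda>i. x i w) (f ` S)) = g (\<lambda>i. x i w)" for w
    by (simp add: g_def row_def cong: if_cong)
  ultimately have ind: "indep_var borel (\<lambda>w. g (\<lambda>i. x i w)) borel (x (f k))"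
    by (simp add: o_def)
  have "AE w in M. g (\<lambda>i. x i w) \<noteq> 0"
    using insert.IH
  proof (rule eventually_mono)
    fix w assume d: "det (\<chi> i. if i \<in> S then x (f i) w else axis i 1) \<noteq> 0"
    have "(\<chi> i. if i = k then axis k 1 else row (\<lambda>i. x i w) i)
        = (\<chi> i. if i \<in> S then x (f i) w else axis i 1)"
      using insert.hyps(2) by (auto simp: vec_eq_iff row_def)
    then have "g (\<lambda>i. x i w) $ k \<noteq> 0" using d by (simp add: g_def)
    then show "g (\<lambda>i. x i w) \<noteq> 0" by auto
  qed
  then have "AE w in M. cdot (g (\<lambda>i. x i w)) (x (f k) w) \<noteq> 0"
    using f(2) by (intro AE_indep_cdot_nonzero[OF ind] hyp) auto
  moreover have "cdot (g (\<lambda>i. x i w)) (x (f k) w)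
      = det (\<chi> i. if i \<in> insert k S then x (f i) w else axis i 1)" for w
    unfolding g_def det_row_expansion[symmetric]
    by (intro arg_cong[where f=det]) (auto simp: vec_eq_iff row_def)
  ultimately show ?case by simp
qed

text \<open>There are finitely many choices of \<open>f\<close>, and each determinant vanishes only
  on a null event.\<close>

lemma (in prob_space) AE_general_position:
  fixes x :: "nat \<Rightarrow> 'a \<Rightarrow> complex^'p"
  assumes indep: "indep_vars (\<lambda>_. borel) x {..<n}"
    and hyp: "\<And>i a. i < n \<Longrightarrow> a \<noteq> 0 \<Longrightarrow> AE y in distr M borel (x i). cdot a y \<noteq> 0"
  shows "AE w in M. general_position n (\<lambda>i. x i w)"
proof -
  let ?F = "{f :: 'p \<Rightarrow> nat. inj f \<and> range f \<subseteq> {..<n}}"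
  have "finite (PiE (UNIV :: 'p set) (\<lambda>_. {..<n}))" by (intro finite_PiE) auto
  then have "finite ?F" by (rule rev_finite_subset) auto
  moreover have "AE w in M. det (\<chi> k. x (f k) w) \<noteq> 0" if "f \<in> ?F" for f
    using AE_det_indep_rows[OF indep, of f UNIV] that hyp by auto
  ultimately have "AE w in M. \<forall>f\<in>?F. det (\<chi> k. x (f k) w) \<noteq> 0"
    by (intro AE_finite_allI)
  then show ?thesis
    by (rule eventually_mono) (simp add: general_position_def)
qed

theorem theorem1:
  fixes M :: "'w measure"
    and n :: nat
    and \<Theta>0 :: "complex^'p^'p"
    and x :: "nat \<Rightarrow> 'w \<Rightarrow> complex^'p"
    and N :: "complex^'p^'p \<Rightarrow> real"
  assumes "prob_space M"
    and "n \<ge> CARD('p) + 1"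
    and "pd \<Theta>0"
    and "\<And>i. i < n \<Longrightarrow> x i \<in> borel_measurable M"
    and "prob_space.indep_vars M (\<lambda>_. borel) x {..<n}"
    and "\<And>i. i < n \<Longrightarrow> distr M borel (x i) = angular_elliptical \<Theta>0"
    and "is_matrix_norm N"
  shows "AE w in M.
           (\<exists>\<Theta> d. coca_minimizer N n (\<lambda>i. x i w) \<Theta> d) \<and>
           (\<forall>\<Theta> d. coca_minimizer N n (\<lambda>i. x i w) \<Theta> d \<longrightarrow>
              tyler_fixed_point n (\<lambda>i. x i w) \<Theta> \<and>
              (\<forall>\<Theta>'. tyler_fixed_point n (\<lambda>i. x i w) \<Theta>' \<longrightarrow> (\<exists>c>0. \<Theta>' = c *\<^sub>R \<Theta>)))"
proof -
  interpret prob_space M by (rule assms(1))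
  \<comment> \<open>Probability enters only here; once the samples are in general position, the
    claim is deterministic.\<close>
  have "AE w in M. general_position n (\<lambda>i. x i w)"
  proof (rule AE_general_position[OF assms(5)])
    show "AE y in distr M borel (x i). cdot a y \<noteq> 0" if "i < n" "a \<noteq> 0" for i a
      unfolding assms(6)[OF that(1)] by (rule AE_angular_elliptical[OF assms(3) that(2)])
  qed
  then show ?thesis
  proof (rule eventually_mono)
    fix w assume "general_position n (\<lambda>i. x i w)"
    then show "(\<exists>\<Theta> d. coca_minimizer N n (\<lambda>i. x i w) \<Theta> d) \<and>
           (\<forall>\<Theta> d. coca_minimizer N n (\<lambda>i. x i w) \<Theta> d \<longrightarrow>
              tyler_fixed_point n (\<lambda>i. x i w) \<Theta> \<and>
              (\<forall>\<Theta>'. tyler_fixed_point n (\<lambda>i. x i w) \<Theta>' \<longrightarrow> (\<exists>c>0. \<Theta>' = c *\<^sub>R \<Theta>)))"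
      using assms(2,7) by (intro coca_eq_tyler_general_position) simp_all
  qed
qed

end
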